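(* Any finite dimensional complex simple Lie algebra $(L,[\cdot,\cdot])$ has a co-split Lie algebra structure; that is, there exists a linear map $\delta:L\to L\otimes L$ such that $(L,[\cdot,\cdot],\delta)$ is a co-split Lie algebra.
   Context: A Lie coalgebra is a pair $(L,\delta)$ with $L$ a vector space and $\delta:L\to L\otimes L$ a linear map such that $(1+\tau)\circ\delta=0$ and $(1+\xi+\xi^2)\circ(1\otimes\delta)\circ\delta=0$, where $\tau(u\otimes v)=v\otimes u$ and $\xi(u\otimes v\otimes w)=v\otimes w\otimes u$. A triple $(L,[\cdot,\cdot],\delta)$ is a co-split Lie algebra if $(L,[\cdot,\cdot])$ is a Lie algebra, $(L,\delta)$ is a Lie coalgebra, and $[\cdot,\cdot]\circ\delta=\mathrm{id}_L$, where $[\cdot,\cdot]$ is regarded as a linear map $L\otimes L\to L$. *)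

theory Defs
  imports Complex_Main "HOL-Library.Poly_Mapping"
begin

section \<open>Complex vector spaces\<close>

class complex_vector = ab_group_add +
  fixes scaleC :: "complex \<Rightarrow> 'a \<Rightarrow> 'a" (infixr \<open>*\<^sub>C\<close> 75)
  assumes scaleC_add_right: "a *\<^sub>C (x + y) = a *\<^sub>C x + a *\<^sub>C y"
    and scaleC_add_left: "(a + b) *\<^sub>C x = a *\<^sub>C x + b *\<^sub>C x"
    and scaleC_scaleC: "a *\<^sub>C b *\<^sub>C x = (a * b) *\<^sub>C x"
    and scaleC_one: "1 *\<^sub>C x = x"

global_interpretation complex_vector: vector_space "scaleC :: complex \<Rightarrow> 'a \<Rightarrow> 'a::complex_vector"
  by unfold_locales (simp_all add: scaleC_add_right scaleC_add_left scaleC_scaleC scaleC_one)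

abbreviation clinear :: "('a::complex_vector \<Rightarrow> 'b::complex_vector) \<Rightarrow> bool"
  where "clinear \<equiv> Vector_Spaces.linear scaleC scaleC"

lemma clinearI:
  assumes "\<And>x y. f (x + y) = f x + f y" "\<And>c x. f (c *\<^sub>C x) = c *\<^sub>C f x"
  shows "clinear f"
  by unfold_locales (use assms in auto)

lemma clinear_add: "clinear f \<Longrightarrow> f (x + y) = f x + f y"
  and clinear_scaleC: "clinear f \<Longrightarrow> f (c *\<^sub>C x) = c *\<^sub>C f x"
  and clinear_diff: "clinear f \<Longrightarrow> f (x - y) = f x - f y"
  and clinear_zero: "clinear f \<Longrightarrow> f 0 = 0"
  by (auto simp: Vector_Spaces.linear_def intro: module_hom.add module_hom.scale module_hom.diff module_hom.zero)

definition cbilinear :: "('a::complex_vector \<Rightarrow> 'b::complex_vector \<Rightarrow> 'c::complex_vector) \<Rightarrow> bool"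
  where "cbilinear f \<longleftrightarrow> (\<forall>x. clinear (f x)) \<and> (\<forall>y. clinear (\<lambda>x. f x y))"

instantiation complex :: complex_vector
begin
definition scaleC_complex :: "complex \<Rightarrow> complex \<Rightarrow> complex" where "scaleC_complex = (*)"
instance by standard (simp_all add: scaleC_complex_def algebra_simps)
end

instantiation poly_mapping :: (type, complex_vector) complex_vector
begin
definition scaleC_poly_mapping :: "complex \<Rightarrow> ('a \<Rightarrow>\<^sub>0 'b) \<Rightarrow> ('a \<Rightarrow>\<^sub>0 'b)"
  where "scaleC_poly_mapping c = Poly_Mapping.map (scaleC c)"

lemma lookup_scaleC [simp]:
  "Poly_Mapping.lookup (c *\<^sub>C (p :: 'a \<Rightarrow>\<^sub>0 'b)) k = c *\<^sub>C Poly_Mapping.lookup p k"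
  by (simp add: scaleC_poly_mapping_def Poly_Mapping.map.rep_eq when_def)

instance
  by standard (auto intro!: poly_mapping_eqI
      simp: lookup_add scaleC_add_right scaleC_add_left scaleC_scaleC scaleC_one)
end


section \<open>Tensor products\<close>

text \<open>The tensor product is the quotient of the free complex vector space on pairs by the subspace
  spanned by the bilinearity relations.\<close>

definition tensor_relators :: "('a::complex_vector \<times> 'b::complex_vector \<Rightarrow>\<^sub>0 complex) set"
  where "tensor_relators =
    {Poly_Mapping.single (x + x', y) 1 - Poly_Mapping.single (x, y) 1 - Poly_Mapping.single (x', y) 1 | x x' y. True}
    \<union> {Poly_Mapping.single (x, y + y') 1 - Poly_Mapping.single (x, y) 1 - Poly_Mapping.single (x, y') 1 | x y y'. True}
    \<union> {Poly_Mapping.single (c *\<^sub>C x, y) 1 - Poly_Mapping.single (x, y) c | c x y. True}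
    \<union> {Poly_Mapping.single (x, c *\<^sub>C y) 1 - Poly_Mapping.single (x, y) c | c x y. True}"

definition tensor_rel ::
    "('a::complex_vector \<times> 'b::complex_vector \<Rightarrow>\<^sub>0 complex) \<Rightarrow> ('a \<times> 'b \<Rightarrow>\<^sub>0 complex) \<Rightarrow> bool"
  where "tensor_rel p q \<longleftrightarrow> p - q \<in> module.span scaleC tensor_relators"

lemma equivp_tensor_rel: "equivp tensor_rel"
proof (rule equivpI)
  show "reflp tensor_rel"
    by (auto simp: reflp_def tensor_rel_def complex_vector.span_zero)
  show "symp tensor_rel"
    by (auto simp: symp_def tensor_rel_def dest: complex_vector.span_neg)
  show "transp tensor_rel"
    unfolding transp_def tensor_rel_def
    using complex_vector.span_add by fastforce
qed

quotient_type (overloaded) ('a, 'b) tensor = "'a::complex_vector \<times> 'b::complex_vector \<Rightarrow>\<^sub>0 complex" / tensor_rel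
  by (rule equivp_tensor_rel)

instantiation tensor :: (complex_vector, complex_vector) complex_vector
begin

lift_definition zero_tensor :: "('a, 'b) tensor" is 0 .

lift_definition plus_tensor :: "('a, 'b) tensor \<Rightarrow> ('a, 'b) tensor \<Rightarrow> ('a, 'b) tensor" is "(+)"
  unfolding tensor_rel_def by (metis add_diff_add complex_vector.span_add)

lift_definition uminus_tensor :: "('a, 'b) tensor \<Rightarrow> ('a, 'b) tensor" is uminus
  unfolding tensor_rel_def by (metis complex_vector.span_neg minus_diff_minus)

lift_definition minus_tensor :: "('a, 'b) tensor \<Rightarrow> ('a, 'b) tensor \<Rightarrow> ('a, 'b) tensor" is "(-)"
  unfolding tensor_rel_def
  by (drule (1) complex_vector.span_diff) (simp add: algebra_simps)

lift_definition scaleC_tensor :: "complex \<Rightarrow> ('a, 'b) tensor \<Rightarrow> ('a, 'b) tensor" is scaleC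
  unfolding tensor_rel_def
  by (metis complex_vector.span_scale complex_vector.scale_right_diff_distrib)

instance
  by (standard; transfer)
     (simp_all add: tensor_rel_def algebra_simps scaleC_scaleC complex_vector.span_zero)

end

lift_definition pure_tensor :: "'a::complex_vector \<Rightarrow> 'b::complex_vector \<Rightarrow> ('a, 'b) tensor"
  (infixr \<open>\<otimes>\<^sub>C\<close> 76) is "\<lambda>x y. Poly_Mapping.single (x, y) 1" .

definition free_lift :: "('a \<Rightarrow> 'b \<Rightarrow> 'c::complex_vector) \<Rightarrow> ('a \<times> 'b \<Rightarrow>\<^sub>0 complex) \<Rightarrow> 'c"
  where "free_lift f p =
    (\<Sum>(x, y)\<in>Poly_Mapping.keys p. Poly_Mapping.lookup p (x, y) *\<^sub>C f x y)"

text \<open>The linear map on the tensor product induced by \<open>f\<close>; it is independent of the chosen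
  representative only for bilinear \<open>f\<close>.\<close>

definition tensor_lift ::
    "('a::complex_vector \<Rightarrow> 'b::complex_vector \<Rightarrow> 'c::complex_vector) \<Rightarrow> ('a, 'b) tensor \<Rightarrow> 'c"
  where "tensor_lift f t = free_lift f (rep_tensor t)"

definition tensor_map :: "('a::complex_vector \<Rightarrow> 'c::complex_vector) \<Rightarrow>
    ('b::complex_vector \<Rightarrow> 'd::complex_vector) \<Rightarrow> ('a, 'b) tensor \<Rightarrow> ('c, 'd) tensor"
  where "tensor_map f g = tensor_lift (\<lambda>x y. f x \<otimes>\<^sub>C g y)"

definition tensor_flip :: "('a::complex_vector, 'b::complex_vector) tensor \<Rightarrow> ('b, 'a) tensor"
  where "tensor_flip = tensor_lift (\<lambda>u v. v \<otimes>\<^sub>C u)"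

definition tensor_cycle ::
    "('a::complex_vector, ('a, 'a) tensor) tensor \<Rightarrow> ('a, ('a, 'a) tensor) tensor"
  where "tensor_cycle = tensor_lift (\<lambda>u. tensor_lift (\<lambda>v w. v \<otimes>\<^sub>C w \<otimes>\<^sub>C u))"


subsection \<open>Universal property\<close>

lemma cbilinear_pure_tensor: "cbilinear (\<otimes>\<^sub>C)"
proof -
  have rel: "tensor_rel p q" if "p - q \<in> tensor_relators" for p q :: "'a \<times> 'b \<Rightarrow>\<^sub>0 complex"
    unfolding tensor_rel_def using that by (rule complex_vector.span_base)
  have single: "c *\<^sub>C Poly_Mapping.single k 1 = Poly_Mapping.single k c" for c and k :: "'a \<times> 'b"
    by (rule poly_mapping_eqI) (auto simp: lookup_single when_def scaleC_complex_def)
  have "(x + x') \<otimes>\<^sub>C y = x \<otimes>\<^sub>C y + x' \<otimes>\<^sub>C y" for x x' :: 'a and y :: 'b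
    by (transfer, rule rel, unfold tensor_relators_def diff_diff_eq[symmetric]) blast
  moreover have "x \<otimes>\<^sub>C (y + y') = x \<otimes>\<^sub>C y + x \<otimes>\<^sub>C y'" for x :: 'a and y y' :: 'b
    by (transfer, rule rel, unfold tensor_relators_def diff_diff_eq[symmetric]) blast
  moreover have "(c *\<^sub>C x) \<otimes>\<^sub>C y = c *\<^sub>C (x \<otimes>\<^sub>C y)" for c and x :: 'a and y :: 'b
    by (transfer, rule rel, unfold tensor_relators_def single) blast
  moreover have "x \<otimes>\<^sub>C (c *\<^sub>C y) = c *\<^sub>C (x \<otimes>\<^sub>C y)" for c and x :: 'a and y :: 'b
    by (transfer, rule rel, unfold tensor_relators_def single) blast
  ultimately show ?thesis
    by (auto simp: cbilinear_def intro!: clinearI)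
qed

lemma pure_tensor_simps:
  "(x + x') \<otimes>\<^sub>C y = x \<otimes>\<^sub>C y + x' \<otimes>\<^sub>C y"
  "x \<otimes>\<^sub>C (y + y') = x \<otimes>\<^sub>C y + x \<otimes>\<^sub>C y'"
  "(c *\<^sub>C x) \<otimes>\<^sub>C y = c *\<^sub>C (x \<otimes>\<^sub>C y)"
  "x \<otimes>\<^sub>C (c *\<^sub>C y) = c *\<^sub>C (x \<otimes>\<^sub>C y)"
  using cbilinear_pure_tensor[where 'a='a and 'b='b]
  by (auto simp: cbilinear_def dest: spec clinear_add clinear_scaleC)

lemma free_lift_superset:
  assumes "finite A" "Poly_Mapping.keys p \<subseteq> A"
  shows "free_lift f p = (\<Sum>(x, y)\<in>A. Poly_Mapping.lookup p (x, y) *\<^sub>C f x y)"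
  unfolding free_lift_def using assms
  by (intro sum.mono_neutral_left) (auto simp: in_keys_iff)

lemma clinear_free_lift: "clinear (free_lift f)"
proof (rule clinearI)
  fix p q :: "'a \<times> 'b \<Rightarrow>\<^sub>0 complex" and c
  let ?A = "Poly_Mapping.keys p \<union> Poly_Mapping.keys q"
  have "free_lift f (p + q) = (\<Sum>(x, y)\<in>?A. Poly_Mapping.lookup (p + q) (x, y) *\<^sub>C f x y)"
    by (rule free_lift_superset) (simp_all add: Poly_Mapping.keys_add)
  also have "\<dots> = (\<Sum>(x, y)\<in>?A. Poly_Mapping.lookup p (x, y) *\<^sub>C f x y)
      + (\<Sum>(x, y)\<in>?A. Poly_Mapping.lookup q (x, y) *\<^sub>C f x y)"
    by (simp add: lookup_add scaleC_add_left sum.distrib case_prod_unfold)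
  also have "\<dots> = free_lift f p + free_lift f q"
    by (simp add: free_lift_superset[of ?A])
  finally show "free_lift f (p + q) = free_lift f p + free_lift f q" .
  have "free_lift f (c *\<^sub>C p)
      = (\<Sum>(x, y)\<in>Poly_Mapping.keys p. Poly_Mapping.lookup (c *\<^sub>C p) (x, y) *\<^sub>C f x y)"
    by (rule free_lift_superset) (auto simp: in_keys_iff scaleC_complex_def)
  then show "free_lift f (c *\<^sub>C p) = c *\<^sub>C free_lift f p"
    by (simp add: free_lift_def complex_vector.scale_sum_right case_prod_unfold
        scaleC_complex_def scaleC_scaleC)
qed

lemma free_lift_single: "free_lift f (Poly_Mapping.single (x, y) c) = c *\<^sub>C f x y"
  by (subst free_lift_superset[of "{(x, y)}"]) auto

lemma free_lift_cong_rel: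
  assumes "cbilinear f" "tensor_rel p q"
  shows "free_lift f p = free_lift f q"
proof -
  have f: "clinear (f x)" "clinear (\<lambda>x. f x y)" for x y
    using assms(1) by (auto simp: cbilinear_def)
  have "free_lift f r = 0" if "r \<in> module.span scaleC tensor_relators" for r
    using that
  proof (induction rule: complex_vector.span_induct_alt)
    case base
    show ?case by (rule clinear_zero[OF clinear_free_lift])
  next
    case (step c r s)
    from step(1) have "free_lift f r = 0"
      by (auto simp: tensor_relators_def clinear_diff[OF clinear_free_lift] free_lift_single
          clinear_add[OF f(1)] clinear_scaleC[OF f(1)] clinear_add[OF f(2)] clinear_scaleC[OF f(2)]
          scaleC_one)
    with step(2) show ?case
      by (simp add: clinear_add[OF clinear_free_lift] clinear_scaleC[OF clinear_free_lift])
  qed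
  with assms(2) have "free_lift f (p - q) = 0"
    by (simp add: tensor_rel_def)
  then show ?thesis
    by (simp add: clinear_diff[OF clinear_free_lift])
qed

lemma tensor_lift_abs: "cbilinear f \<Longrightarrow> tensor_lift f (abs_tensor p) = free_lift f p"
  unfolding tensor_lift_def
  by (rule free_lift_cong_rel)
     (simp_all add: Quotient3_rep_abs[OF Quotient3_tensor] equivp_reflp[OF equivp_tensor_rel])

lemma tensor_lift_pure: "cbilinear f \<Longrightarrow> tensor_lift f (x \<otimes>\<^sub>C y) = f x y"
  by (simp add: pure_tensor.abs_eq tensor_lift_abs free_lift_single scaleC_one)

lemma clinear_tensor_lift:
  assumes "cbilinear f"
  shows "clinear (tensor_lift f)"
proof (rule clinearI)
  fix s t :: "('a, 'b) tensor" and c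
  show "tensor_lift f (s + t) = tensor_lift f s + tensor_lift f t"
    by (induct s, induct t)
       (simp add: plus_tensor.abs_eq tensor_lift_abs assms clinear_add[OF clinear_free_lift])
  show "tensor_lift f (c *\<^sub>C s) = c *\<^sub>C tensor_lift f s"
    by (induct s)
       (simp add: scaleC_tensor.abs_eq tensor_lift_abs assms clinear_scaleC[OF clinear_free_lift])
qed

lemma span_pure_tensors:
  "module.span scaleC {x \<otimes>\<^sub>C y | x y. True} = (UNIV :: ('a::complex_vector, 'b::complex_vector) tensor set)"
proof -
  have "abs_tensor p \<in> module.span scaleC {x \<otimes>\<^sub>C y | x y. True}" for p :: "'a \<times> 'b \<Rightarrow>\<^sub>0 complex"
  proof (induct p rule: update_induct)
    case const
    show ?case
      by (metis zero_tensor.abs_eq complex_vector.span_zero)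
  next
    case (update p k c)
    have "Poly_Mapping.update k c p = c *\<^sub>C Poly_Mapping.single k 1 + p"
      using update(1)
      by (intro poly_mapping_eqI)
         (auto simp: lookup_update lookup_add lookup_single when_def scaleC_complex_def in_keys_iff)
    then have "abs_tensor (Poly_Mapping.update k c p) = c *\<^sub>C (fst k \<otimes>\<^sub>C snd k) + abs_tensor p"
      by (simp add: pure_tensor.abs_eq scaleC_tensor.abs_eq plus_tensor.abs_eq)
    moreover have "fst k \<otimes>\<^sub>C snd k \<in> {x \<otimes>\<^sub>C y | x y. True}"
      by blast
    ultimately show ?case
      using update(3) by (simp only: complex_vector.span_add complex_vector.span_scale complex_vector.span_base)
  qed
  then have "t \<in> module.span scaleC {x \<otimes>\<^sub>C y | x y. True}" for t :: "('a, 'b) tensor"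
    by (induct t)
  then show ?thesis
    by blast
qed

lemma clinear_eq_on_pure:
  fixes g h :: "('a::complex_vector, 'b::complex_vector) tensor \<Rightarrow> 'c::complex_vector"
  assumes "clinear g" "clinear h" "\<And>x y. g (x \<otimes>\<^sub>C y) = h (x \<otimes>\<^sub>C y)"
  shows "g = h"
proof
  fix t :: "('a, 'b) tensor"
  have "t \<in> module.span scaleC {x \<otimes>\<^sub>C y | x y. True}"
    by (simp only: span_pure_tensors UNIV_I)
  then show "g t = h t"
  proof (induction rule: complex_vector.span_induct_alt)
    case base
    show ?case by (simp add: clinear_zero assms(1,2))
  next
    case (step c x y)
    then show ?case
      using assms by (auto simp: clinear_add clinear_scaleC)
  qed
qed

lemma cbilinear_pure_compose:
  assumes "clinear f" "clinear g"
  shows "cbilinear (\<lambda>x y. f x \<otimes>\<^sub>C g y)"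
  by (auto simp: cbilinear_def clinear_add[OF assms(1)] clinear_add[OF assms(2)]
      clinear_scaleC[OF assms(1)] clinear_scaleC[OF assms(2)] pure_tensor_simps intro!: clinearI)

lemma tensor_map_pure:
  "clinear f \<Longrightarrow> clinear g \<Longrightarrow> tensor_map f g (x \<otimes>\<^sub>C y) = f x \<otimes>\<^sub>C g y"
  by (simp add: tensor_map_def tensor_lift_pure cbilinear_pure_compose)

lemma clinear_tensor_map: "clinear f \<Longrightarrow> clinear g \<Longrightarrow> clinear (tensor_map f g)"
  by (simp add: tensor_map_def clinear_tensor_lift cbilinear_pure_compose)

lemma cbilinear_flip: "cbilinear f \<Longrightarrow> cbilinear (\<lambda>x y. f y x)"
  by (auto simp: cbilinear_def)

lemma tensor_flip_pure: "tensor_flip (u \<otimes>\<^sub>C v) = v \<otimes>\<^sub>C u"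
  by (simp add: tensor_flip_def tensor_lift_pure cbilinear_flip cbilinear_pure_tensor)

lemma clinear_tensor_flip: "clinear tensor_flip"
  by (simp add: tensor_flip_def clinear_tensor_lift cbilinear_flip cbilinear_pure_tensor)

lemma cbilinear_cycle_inner: "cbilinear (\<lambda>v w. v \<otimes>\<^sub>C w \<otimes>\<^sub>C u)"
  by (auto simp: cbilinear_def pure_tensor_simps intro!: clinearI)

lemma cbilinear_cycle_outer:
  "cbilinear (\<lambda>u :: 'c::complex_vector.
    tensor_lift (\<lambda>(v :: 'a::complex_vector) (w :: 'b::complex_vector). v \<otimes>\<^sub>C w \<otimes>\<^sub>C u))"
  unfolding cbilinear_def
proof (intro conjI allI)
  show "clinear (tensor_lift (\<lambda>(v :: 'a) (w :: 'b). v \<otimes>\<^sub>C w \<otimes>\<^sub>C u))" for u :: 'c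
    by (rule clinear_tensor_lift[OF cbilinear_cycle_inner])
  show "clinear (\<lambda>u :: 'c. tensor_lift (\<lambda>(v :: 'a) (w :: 'b). v \<otimes>\<^sub>C w \<otimes>\<^sub>C u) t)" for t :: "('a, 'b) tensor"
    by (rule clinearI)
       (simp_all add: tensor_lift_def free_lift_def pure_tensor_simps scaleC_add_right sum.distrib
          case_prod_unfold complex_vector.scale_sum_right mult.commute)
qed

lemma tensor_cycle_pure: "tensor_cycle (u \<otimes>\<^sub>C v \<otimes>\<^sub>C w) = v \<otimes>\<^sub>C w \<otimes>\<^sub>C u"
  by (simp add: tensor_cycle_def tensor_lift_pure cbilinear_cycle_inner cbilinear_cycle_outer)

lemma clinear_tensor_cycle: "clinear tensor_cycle"
  by (simp add: tensor_cycle_def clinear_tensor_lift cbilinear_cycle_outer)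


section \<open>Lie algebras and Lie coalgebras\<close>

locale lie_algebra =
  fixes bracket :: "'a::complex_vector \<Rightarrow> 'a \<Rightarrow> 'a"
  assumes cbilinear_bracket: "cbilinear bracket"
    and bracket_self: "bracket x x = 0"
    and jacobi: "bracket x (bracket y z) + bracket y (bracket z x) + bracket z (bracket x y) = 0"
begin

definition lie_ideal :: "'a set \<Rightarrow> bool"
  where "lie_ideal I \<longleftrightarrow> module.subspace scaleC I \<and> (\<forall>x. \<forall>y\<in>I. bracket x y \<in> I)"

end

locale simple_lie_algebra = lie_algebra +
  assumes nonabelian: "\<exists>x y. bracket x y \<noteq> 0"
    and ideal_trivial: "lie_ideal I \<Longrightarrow> I = {0} \<or> I = UNIV"

locale lie_coalgebra =
  fixes \<delta> :: "'a::complex_vector \<Rightarrow> ('a, 'a) tensor"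
  assumes clinear_cobracket: "clinear \<delta>"
    and co_antisymmetric: "\<delta> x + tensor_flip (\<delta> x) = 0"
    and co_jacobi: "tensor_map id \<delta> (\<delta> x)
      + tensor_cycle (tensor_map id \<delta> (\<delta> x))
      + tensor_cycle (tensor_cycle (tensor_map id \<delta> (\<delta> x))) = 0"

locale co_split_lie_algebra = lie_algebra bracket + lie_coalgebra \<delta>
  for bracket :: "'a::complex_vector \<Rightarrow> 'a \<Rightarrow> 'a" and \<delta> :: "'a \<Rightarrow> ('a, 'a) tensor" +
  assumes co_split: "tensor_lift bracket \<circ> \<delta> = id"

end

theory Submission
  imports Defs "HOL-Computational_Algebra.Fundamental_Theorem_Algebra"
begin

text \<open>
  By Cartan's criterion the Killing form of a simple Lie algebra \<open>L\<close> is nondegenerate. It therefore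
  identifies \<open>L\<close> with its dual space, and the transpose of the bracket becomes a Lie cobracket on
  \<open>L\<close>. With a suitable choice of the sign, this cobracket sends \<open>x\<close> to the sum of the tensors
  \<open>[x, b] \<otimes> b'\<close>, where \<open>b\<close> runs through a basis with Killing-dual basis \<open>b'\<close>. Its coantisymmetry
  and co-Jacobi identity are antisymmetry and Jacobi identity of the bracket, read off from coefficients (\<open>cobracket_coordinates\<close>,
  \<open>cobracket_iterated\<close>). Composing it with the bracket gives the Casimir operator
  of the adjoint representation with respect to the Killing form. Pairing it with \<open>y\<close> gives
  \<open>tr (ad y ad x)\<close>, which is the Killing form of \<open>y\<close> and \<open>x\<close> again, so this operator is the identity
  (\<open>bracket_cobracket\<close>).

  Nondegeneracy (\<open>killing_nondegenerate\<close>) is the substantial part. The radical of the Killing form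
  is an ideal, so one has to exclude that the form vanishes. Let \<open>x\<close> be any element and let \<open>D\<close> be
  the operator that acts as the conjugate \<open>cnj \<lambda>\<close> on the generalized eigenspace of \<open>ad x\<close> for the
  eigenvalue \<open>\<lambda>\<close>. As conjugation is additive, \<open>D\<close> is a derivation (\<open>conjugate_derivation\<close>). For a
  vanishing Killing form, the derivation property and the cyclicity of the trace yield
  \<open>tr (ad [a, b] D) = 0\<close> for all \<open>a\<close> and \<open>b\<close>; as brackets span \<open>L\<close>, also
  \<open>tr (ad x D) = \<Sum>|\<lambda>|\<^sup>2\<close> is zero. So all \<open>ad x\<close> are nilpotent (\<open>ad_nilpotent_of_killing_zero\<close>),
  and Engel's theorem (\<open>engel_center\<close>) produces a nonzero central element, which a simple Lie
  algebra does not have.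

  Generalized eigenspaces are handled by chains of vectors on which the operator is triangular
  (\<open>adapted_chain\<close>), because these give access to traces at the same time. Quotient
  representations are replaced by pairs of subspaces throughout.
\<close>


section \<open>Eigenvectors modulo a subspace\<close>

lemma clinear_sum: "clinear f \<Longrightarrow> f (\<Sum>i\<in>A. g i) = (\<Sum>i\<in>A. f (g i))"
  by (induction A rule: infinite_finite_induct) (simp_all add: clinear_add clinear_zero)

lemma clinear_compose: "clinear f \<Longrightarrow> clinear g \<Longrightarrow> clinear (\<lambda>x. f (g x))"
  by (rule clinearI) (simp_all add: clinear_add clinear_scaleC)

definition poly_op :: "('a \<Rightarrow> 'a) \<Rightarrow> complex poly \<Rightarrow> 'a \<Rightarrow> 'a::complex_vector"
  where "poly_op T p v = (\<Sum>i\<le>degree p. coeff p i *\<^sub>C (T ^^ i) v)"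

lemma poly_op_extend:
  "degree p \<le> N \<Longrightarrow> poly_op T p v = (\<Sum>i\<le>N. coeff p i *\<^sub>C (T ^^ i) v)"
  unfolding poly_op_def
  by (rule sum.mono_neutral_left) (auto simp: coeff_eq_0)

lemma poly_op_add: "poly_op T (p + q) v = poly_op T p v + poly_op T q v"
proof -
  define N where "N = max (degree p) (degree q)"
  have "degree (p + q) \<le> N" "degree p \<le> N" "degree q \<le> N"
    by (auto simp: N_def intro: degree_add_le_max)
  then show ?thesis
    by (simp add: poly_op_extend[of _ N] scaleC_add_left sum.distrib)
qed

lemma poly_op_smult: "poly_op T (smult c p) v = c *\<^sub>C poly_op T p v"
  using poly_op_extend[of "smult c p" "degree p" T v]
  by (simp add: degree_smult_le poly_op_def complex_vector.scale_sum_right scaleC_scaleC)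

lemma poly_op_minus: "poly_op T (- p) v = - poly_op T p v"
  by (simp add: poly_op_def sum_negf)

lemma poly_op_diff: "poly_op T (p - q) v = poly_op T p v - poly_op T q v"
  using poly_op_add[of T p "- q" v] by (simp add: poly_op_minus)

lemma poly_op_monom: "poly_op T (monom c k) v = c *\<^sub>C (T ^^ k) v"
proof -
  have "poly_op T (monom c k) v = (\<Sum>i\<le>k. (if k = i then c else 0) *\<^sub>C (T ^^ i) v)"
    by (simp add: poly_op_extend[of _ k] degree_monom_le)
  also have "\<dots> = (\<Sum>i\<in>{k}. c *\<^sub>C (T ^^ i) v)"
    by (rule sum.mono_neutral_cong_right) auto
  finally show ?thesis by simp
qed

lemma poly_op_mult_X:
  assumes "clinear T"
  shows "poly_op T (pCons 0 p) v = T (poly_op T p v)"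
proof -
  have "poly_op T (pCons 0 p) v = (\<Sum>i\<le>Suc (degree p). coeff (pCons 0 p) i *\<^sub>C (T ^^ i) v)"
    by (rule poly_op_extend) (simp add: degree_pCons_le)
  also have "\<dots> = (\<Sum>i\<le>degree p. coeff p i *\<^sub>C T ((T ^^ i) v))"
    by (subst sum.atMost_Suc_shift) simp
  also have "\<dots> = T (poly_op T p v)"
    by (simp add: poly_op_def clinear_sum[OF assms] clinear_scaleC[OF assms])
  finally show ?thesis .
qed

text \<open>The usual argument for the existence of eigenvectors, carried out modulo \<open>V\<close> so that no
  quotient space is needed: splitting off a linear factor \<open>X - \<mu>\<close> of \<open>p\<close>, either the cofactor
  already maps \<open>w\<close> into \<open>V\<close>, or it maps \<open>w\<close> to an eigenvector modulo \<open>V\<close>.\<close>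
lemma eigenvector_modulo_of_poly:
  fixes T :: "'a::complex_vector \<Rightarrow> 'a"
  assumes T: "clinear T" and V: "complex_vector.subspace V"
  shows "p \<noteq> 0 \<Longrightarrow> w \<notin> V \<Longrightarrow> poly_op T p w \<in> V \<Longrightarrow> \<exists>w' \<mu>. w' \<notin> V \<and> T w' - \<mu> *\<^sub>C w' \<in> V"
proof (induction "degree p" arbitrary: p rule: less_induct)
  case less
  show ?case
  proof (cases "degree p = 0")
    case True
    then obtain c where p: "p = [:c:]" by (rule degree_eq_zeroE)
    with less.prems have "c \<noteq> 0" "c *\<^sub>C w \<in> V" by (auto simp: poly_op_def)
    then have "w \<in> V"
      using complex_vector.subspace_scale[OF V, of "c *\<^sub>C w" "inverse c"]
      by (simp add: scaleC_scaleC scaleC_one)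
    with less.prems show ?thesis by simp
  next
    case False
    then obtain \<mu> where \<mu>: "poly p \<mu> = 0"
      using fundamental_theorem_of_algebra[of p] by (auto simp: constant_degree)
    define q where "q = synthetic_div p \<mu>"
    have p: "p = pCons 0 q - smult \<mu> q"
      using synthetic_div_correct[of p \<mu>] \<mu> unfolding q_def by (simp add: eq_diff_eq)
    have "q \<noteq> 0" "degree q < degree p"
      using False by (auto simp: q_def synthetic_div_eq_0_iff degree_synthetic_div)
    have "poly_op T p w = T (poly_op T q w) - \<mu> *\<^sub>C poly_op T q w"
      by (subst p) (simp add: poly_op_diff poly_op_smult poly_op_mult_X[OF T])
    with less.prems \<open>q \<noteq> 0\<close> \<open>degree q < degree p\<close> less.hyps[of q] show ?thesis
      by (cases "poly_op T q w \<in> V") auto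
  qed
qed

locale fin_dim_complex = finite_dimensional_vector_space scaleC Basis
  for Basis :: "'a::complex_vector set"
begin

lemma independent_sequence:
  fixes n :: nat
  assumes "\<And>i. i < n \<Longrightarrow> v i \<notin> span (v ` {..<i})"
  shows "inj_on v {..<n} \<and> independent (v ` {..<n})"
  using assms
proof (induction n)
  case 0
  show ?case by (simp add: independent_empty)
next
  case (Suc n)
  have "v n \<notin> v ` {..<n}"
    using Suc.prems[of n] span_base[of "v n" "v ` {..<n}"] by auto
  moreover have "inj_on v {..<n} \<and> independent (v ` {..<n})"
    using Suc.prems by (intro Suc.IH) simp
  moreover have "v n \<notin> span (v ` {..<n})"
    using Suc.prems by simp
  ultimately show ?case
    by (simp add: lessThan_Suc independent_insertI)
qed

lemma independent_sequence_bound: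
  fixes n :: nat
  assumes "\<And>i. i < n \<Longrightarrow> v i \<notin> span (v ` {..<i})"
  shows "n \<le> card Basis"
proof -
  have "inj_on v {..<n}" "independent (v ` {..<n})"
    using independent_sequence[of n v] assms by auto
  then have "card (v ` {..<n}) = n" "card (v ` {..<n}) \<le> dim UNIV"
    by (simp add: card_image, intro independent_card_le_dim) auto
  then show ?thesis by simp
qed

text \<open>Some \<open>T\<^sup>k w\<close> depends linearly on the lower iterates, for otherwise the iterates would form an
  arbitrarily long independent sequence.\<close>
lemma annihilating_poly: "\<exists>p. p \<noteq> 0 \<and> poly_op T p (w :: 'a) = 0"
proof -
  define u where "u i = (T ^^ i) w" for i
  obtain k where k: "u k \<in> span (u ` {..<k})"
    using independent_sequence_bound[of "Suc (card Basis)" u] by auto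
  have "\<exists>q. (\<forall>i\<ge>k. coeff q i = 0) \<and> poly_op T q w = x" if "x \<in> span (u ` {..<k})" for x
    using that
  proof (induction rule: span_induct_alt)
    case base
    show ?case by (rule exI[of _ 0]) (simp add: poly_op_def)
  next
    case (step c x y)
    then obtain i q where "i < k" "x = u i" "\<forall>i\<ge>k. coeff q i = 0" "poly_op T q w = y"
      by auto
    then show ?case
      by (intro exI[of _ "monom c i + q"]) (auto simp: poly_op_add poly_op_monom u_def)
  qed
  with k obtain q where q: "\<forall>i\<ge>k. coeff q i = 0" "poly_op T q w = u k" by blast
  have "coeff (monom 1 k - q) k = 1" using q by simp
  then have "monom 1 k - q \<noteq> 0" by (metis coeff_0 zero_neq_one)
  moreover have "poly_op T (monom 1 k - q) w = 0"
    using q by (simp add: poly_op_diff poly_op_monom u_def scaleC_one)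
  ultimately show ?thesis by blast
qed

lemma eigenvector_modulo:
  assumes "clinear T" "subspace V" "V \<noteq> UNIV"
  obtains w \<mu> where "w \<notin> V" "T w - \<mu> *\<^sub>C w \<in> V"
proof -
  obtain w where "w \<notin> V" using assms(3) by blast
  moreover obtain p where "p \<noteq> 0" "poly_op T p w = 0" using annihilating_poly by blast
  ultimately show ?thesis
    using eigenvector_modulo_of_poly[OF assms(1,2), of p w] that subspace_0[OF assms(2)] by auto
qed


section \<open>The trace\<close>

lemma clinear_representation:
  assumes "independent B" "span B = UNIV"
  shows "clinear (\<lambda>u. representation B u b)"
  using assms
  by (intro clinearI) (auto simp: representation_add representation_scale scaleC_complex_def)

lemma sum_representation:
  assumes "independent B" "span B = UNIV"
  shows "(\<Sum>b\<in>B. representation B u b *\<^sub>C b) = u"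
  using assms by (intro sum_representation_eq) (auto intro: finiteI_independent)

text \<open>Both sides are the double sum of the products of the matrix entries of \<open>f\<close> and \<open>g\<close> with respect
  to the two bases. For \<open>C = B\<close> this is the cyclicity of the trace, and for \<open>g = id\<close> its
  independence of the basis.\<close>
lemma trace_swap_bases:
  assumes B: "independent B" "span B = UNIV" and C: "independent C" "span C = UNIV"
    and f: "clinear f" and g: "clinear g"
  shows "(\<Sum>b\<in>B. representation B (f (g b)) b) = (\<Sum>c\<in>C. representation C (g (f c)) c)"
proof -
  have expand: "representation B (f (g b)) b =
      (\<Sum>c\<in>C. representation C (g b) c * representation B (f c) b)"
    if B: "independent B" "span B = UNIV" and C: "independent C" "span C = UNIV"
      and f: "clinear f" for B C f g and b :: 'a
  proof -
    have "f (g b) = f (\<Sum>c\<in>C. representation C (g b) c *\<^sub>C c)"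
      by (simp only: sum_representation[OF C])
    then show ?thesis
      by (simp add: clinear_sum[OF f] clinear_scaleC[OF f] clinear_sum[OF clinear_representation[OF B]]
          clinear_scaleC[OF clinear_representation[OF B]] scaleC_complex_def)
  qed
  have "(\<Sum>b\<in>B. representation B (f (g b)) b) =
      (\<Sum>b\<in>B. \<Sum>c\<in>C. representation C (g b) c * representation B (f c) b)"
    by (intro sum.cong refl expand[OF B C f])
  also have "\<dots> = (\<Sum>c\<in>C. \<Sum>b\<in>B. representation B (f c) b * representation C (g b) c)"
    by (subst sum.swap) (simp add: mult.commute)
  also have "\<dots> = (\<Sum>c\<in>C. representation C (g (f c)) c)"
    by (intro sum.cong refl expand[OF C B g, symmetric])
  finally show ?thesis .
qed

definition trace :: "('a \<Rightarrow> 'a) \<Rightarrow> complex"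
  where "trace f = (\<Sum>b\<in>Basis. representation Basis (f b) b)"

lemma trace_basis:
  assumes "independent B" "span B = UNIV" "clinear f"
  shows "trace f = (\<Sum>b\<in>B. representation B (f b) b)"
  unfolding trace_def
  using trace_swap_bases[OF independent_Basis span_Basis assms(1,2), of "\<lambda>x. x" f] assms
  by (auto intro: clinearI)

lemma trace_commute: "clinear f \<Longrightarrow> clinear g \<Longrightarrow> trace (\<lambda>x. f (g x)) = trace (\<lambda>x. g (f x))"
  unfolding trace_def
  by (rule trace_swap_bases) (auto simp: independent_Basis span_Basis)

lemma trace_add: "trace (\<lambda>x. f x + g x) = trace f + trace g"
  by (simp add: trace_def representation_add[OF independent_Basis] span_Basis sum.distrib)

lemma trace_scale: "trace (\<lambda>x. c *\<^sub>C f x) = c * trace f"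
  by (simp add: trace_def representation_scale[OF independent_Basis] span_Basis sum_distrib_left)

lemma trace_diff: "trace (\<lambda>x. f x - g x) = trace f - trace g"
  by (simp add: trace_def representation_diff[OF independent_Basis] span_Basis sum_subtractf)


section \<open>Chains of generalized eigenvectors\<close>

text \<open>A sequence of independent vectors on which \<open>T\<close> is upper triangular with diagonal \<open>l\<close>, and in
  which \<open>T\<close> moreover only links vectors with the same diagonal entry. A chain that spans the
  space thus encodes both the decomposition into generalized eigenspaces (group the vectors by
  their value of \<open>l\<close>) and a triangular form of \<open>T\<close> on each of them.\<close>
definition adapted_chain :: "('a \<Rightarrow> 'a) \<Rightarrow> nat \<Rightarrow> (nat \<Rightarrow> 'a) \<Rightarrow> (nat \<Rightarrow> complex) \<Rightarrow> bool"
  where "adapted_chain T n v l \<longleftrightarrow> (\<forall>i<n. v i \<notin> span (v ` {..<i}) \<and>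
    T (v i) - l i *\<^sub>C v i \<in> span (v ` {j. j < i \<and> l j = l i}))"

text \<open>Off the generalized eigenspace of \<open>\<mu>\<close> the operator \<open>T - \<mu>\<close> is invertible: it is triangular with
  nonzero diagonal entries, so that one can solve for the chain vectors one after the other.\<close>
lemma adapted_chain_shift_surj:
  assumes T: "clinear T" and ch: "adapted_chain T n v l"
  shows "i < n \<Longrightarrow> l i \<noteq> \<mu> \<Longrightarrow> \<exists>z\<in>span (v ` {..<n}). v i = T z - \<mu> *\<^sub>C z"
proof (induction i rule: less_induct)
  case (less i)
  let ?f = "\<lambda>z. T z - \<mu> *\<^sub>C z"
  let ?R = "?f ` span (v ` {..<n})"
  have f: "clinear ?f"
    by (rule clinearI) (simp_all add: clinear_add[OF T] clinear_scaleC[OF T] algebra_simps)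
  have R: "subspace ?R"
    by (rule module_hom.subspace_image) (use f in \<open>auto simp: Vector_Spaces.linear_def\<close>)
  let ?d = "T (v i) - l i *\<^sub>C v i"
  have "?d \<in> span (v ` {j. j < i \<and> l j = l i})"
    using ch less.prems by (auto simp: adapted_chain_def)
  also have "\<dots> \<subseteq> ?R"
    using less R by (intro span_minimal) (auto simp: image_iff)
  finally have "?d \<in> ?R" .
  moreover have "?f (v i) \<in> ?R"
    using less.prems by (intro imageI span_base) auto
  ultimately have "?f (v i) - ?d \<in> ?R" by (rule subspace_diff[OF R, rotated])
  then have "inverse (l i - \<mu>) *\<^sub>C (?f (v i) - ?d) \<in> ?R" by (rule subspace_scale[OF R])
  moreover have "inverse (l i - \<mu>) *\<^sub>C (?f (v i) - ?d) = v i"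
    using less.prems by (simp add: scaleC_scaleC scaleC_one flip: scale_left_diff_distrib)
  ultimately show ?case by auto
qed

text \<open>An eigenvector \<open>w\<close> modulo the span of the chain has an error term \<open>T w - \<mu> w\<close> with components
  in all generalized eigenspaces. The components that do not belong to \<open>\<mu>\<close> lie in the image of
  \<open>T - \<mu>\<close>, hence can be removed by correcting \<open>w\<close> within the span.\<close>
lemma adapted_chain_extend:
  assumes T: "clinear T" and ch: "adapted_chain T n v l" and ne: "span (v ` {..<n}) \<noteq> UNIV"
  shows "\<exists>v l. adapted_chain T (Suc n) v l"
proof -
  let ?V = "span (v ` {..<n})"
  obtain w \<mu> where w: "w \<notin> ?V" "T w - \<mu> *\<^sub>C w \<in> ?V"
    using eigenvector_modulo[OF T _ ne] by auto
  let ?W = "span (v ` {j. j < n \<and> l j = \<mu>})"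
  have "\<exists>z\<in>?V. \<exists>g\<in>?W. u = T z - \<mu> *\<^sub>C z + g" if "u \<in> ?V" for u
    using that
  proof (induction rule: span_induct_alt)
    case base
    show ?case by (intro bexI[of _ 0]) (auto simp: span_zero clinear_zero[OF T])
  next
    case (step c x y)
    then obtain z g where zg: "z \<in> ?V" "g \<in> ?W" "y = T z - \<mu> *\<^sub>C z + g" by blast
    obtain i where i: "i < n" "x = v i" using step by auto
    show ?case
    proof (cases "l i = \<mu>")
      case True
      then have "x \<in> ?W" using i by (auto intro!: span_base)
      then show ?thesis
        using zg by (intro bexI[of _ z] bexI[of _ "c *\<^sub>C x + g"]) (auto intro: span_add span_scale)
    next
      case False
      then obtain z' where "z' \<in> ?V" "x = T z' - \<mu> *\<^sub>C z'"
        using adapted_chain_shift_surj[OF T ch i(1)] i by auto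
      with zg have "c *\<^sub>C z' + z \<in> ?V"
        "c *\<^sub>C x + y = T (c *\<^sub>C z' + z) - \<mu> *\<^sub>C (c *\<^sub>C z' + z) + g"
        by (auto simp: clinear_add[OF T] clinear_scaleC[OF T] scale_right_distrib
            scale_right_diff_distrib scale_left_commute intro: span_add span_scale)
      with zg(2) show ?thesis by blast
    qed
  qed
  with w obtain z g where zg: "z \<in> ?V" "g \<in> ?W" "T w - \<mu> *\<^sub>C w = T z - \<mu> *\<^sub>C z + g" by blast
  let ?v = "v(n := w - z)" and ?l = "l(n := \<mu>)"
  have "adapted_chain T (Suc n) ?v ?l"
    unfolding adapted_chain_def
  proof (intro allI impI)
    fix i assume "i < Suc n"
    have im: "?v ` {..<i} = v ` {..<i}"
      using \<open>i < Suc n\<close> by (intro image_cong) auto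
    have im': "?v ` {j. j < i \<and> ?l j = ?l i} = v ` {j. j < i \<and> l j = ?l i}"
      using \<open>i < Suc n\<close> by (intro image_cong) auto
    have "w - z \<notin> ?V"
      using w zg span_add[of "w - z" _ z] by auto
    moreover have "T (w - z) - \<mu> *\<^sub>C (w - z) = g"
      using zg(3) by (simp add: clinear_diff[OF T] algebra_simps)
    ultimately show "?v i \<notin> span (?v ` {..<i}) \<and>
        T (?v i) - ?l i *\<^sub>C ?v i \<in> span (?v ` {j. j < i \<and> ?l j = ?l i})"
      unfolding im im' using \<open>i < Suc n\<close> ch zg(2) by (cases "i = n") (auto simp: adapted_chain_def)
  qed
  then show ?thesis by blast
qed

text \<open>A chain of maximal length spans the whole space, since it could be extended otherwise.\<close>
lemma ex_full_adapted_chain: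
  assumes "clinear T"
  obtains n v l where "adapted_chain T n v l" "span (v ` {..<n}) = UNIV"
proof -
  define P where "P n \<longleftrightarrow> (\<exists>v l. adapted_chain T n v l)" for n
  have "P 0" by (simp add: P_def adapted_chain_def)
  moreover have bound: "P n \<Longrightarrow> n \<le> card Basis" for n
    by (auto simp: P_def adapted_chain_def intro: independent_sequence_bound)
  ultimately have "P (Greatest P)" "\<not> P (Suc (Greatest P))"
    using GreatestI_nat[of P 0 "card Basis"] Greatest_le_nat[of P "Suc (Greatest P)" "card Basis"]
    by (auto simp: Suc_le_eq)
  then show ?thesis
    using adapted_chain_extend[OF assms] that unfolding P_def by blast
qed

lemma adapted_chain_nilpart:
  assumes "adapted_chain T n v l" "i < n" "i \<le> m"
  shows "T (v i) - l i *\<^sub>C v i \<in> span (v ` {..<m})"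
proof -
  have "T (v i) - l i *\<^sub>C v i \<in> span (v ` {j. j < i \<and> l j = l i})"
    using assms by (simp add: adapted_chain_def)
  also have "\<dots> \<subseteq> span (v ` {..<m})"
    using assms(3) by (intro span_mono) auto
  finally show ?thesis .
qed

lemma adapted_chain_invariant:
  assumes T: "clinear T" and ch: "adapted_chain T n v l" and m: "m \<le> n" and u: "u \<in> span (v ` {..<m})"
  shows "T u \<in> span (v ` {..<m})"
  using u
proof (induction rule: span_induct_alt)
  case base
  show ?case by (simp add: clinear_zero[OF T] span_zero)
next
  case (step c x y)
  then obtain i where i: "i < m" "x = v i" by auto
  have "T x - l i *\<^sub>C x \<in> span (v ` {..<m})"
    using adapted_chain_nilpart[OF ch, of i m] i m by simp
  moreover have "l i *\<^sub>C x \<in> span (v ` {..<m})"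
    using i by (intro span_scale span_base) auto
  ultimately have "T x \<in> span (v ` {..<m})"
    using span_add by fastforce
  with step.IH show ?case
    by (simp add: clinear_add[OF T] clinear_scaleC[OF T] span_add span_scale)
qed

text \<open>The operator \<open>T - \<nu>\<close> is injective modulo the generalized eigenspace of \<open>\<nu>\<close>: if the
  last chain vector occurring in \<open>u\<close> belonged to another eigenvalue, it would still occur in
  \<open>T u - \<nu> u\<close>. Membership in a generalized eigenspace can thus be tested by applying \<open>T - \<nu>\<close>
  once.\<close>
lemma adapted_chain_eigen_closed:
  assumes T: "clinear T" and ch: "adapted_chain T n v l"
  defines "W \<equiv> \<lambda>\<nu>. span (v ` {k. k < n \<and> l k = \<nu>})"
  shows "m \<le> n \<Longrightarrow> u \<in> span (v ` {..<m}) \<Longrightarrow> T u - \<nu> *\<^sub>C u \<in> W \<nu> \<Longrightarrow> u \<in> W \<nu>"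
proof (induction m arbitrary: u)
  case 0
  then show ?case by (simp add: W_def span_zero)
next
  case (Suc m)
  have inj: "inj_on v {..<n}" and ind: "independent (v ` {..<n})"
    using independent_sequence[of n v] ch by (auto simp: adapted_chain_def)
  have "u \<in> span (insert (v m) (v ` {..<m}))"
    using Suc.prems by (simp add: lessThan_Suc)
  then obtain c where c: "u - c *\<^sub>C v m \<in> span (v ` {..<m})"
    using span_breakdown_eq by blast
  define u' where "u' = u - c *\<^sub>C v m"
  have u: "u = u' + c *\<^sub>C v m" by (simp add: u'_def)
  have split: "T u - \<nu> *\<^sub>C u =
      (T u' - \<nu> *\<^sub>C u') + c *\<^sub>C (T (v m) - l m *\<^sub>C v m) + (c * (l m - \<nu>)) *\<^sub>C v m"
    unfolding u
    by (simp add: clinear_add[OF T] clinear_scaleC[OF T] scale_right_distrib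
        scale_right_diff_distrib scale_left_diff_distrib mult.commute right_diff_distrib)
  show ?case
  proof (cases "l m = \<nu>")
    case True
    have vm: "v m \<in> W \<nu>"
      using True Suc.prems(1) unfolding W_def by (intro span_base) auto
    have "T (v m) - l m *\<^sub>C v m \<in> span (v ` {j. j < m \<and> l j = l m})"
      using ch Suc.prems(1) by (auto simp: adapted_chain_def)
    also have "\<dots> \<subseteq> W \<nu>"
      unfolding W_def using True Suc.prems(1) by (intro span_mono) auto
    finally have "c *\<^sub>C (T (v m) - l m *\<^sub>C v m) \<in> W \<nu>" by (simp add: W_def span_scale)
    moreover have "T u' - \<nu> *\<^sub>C u' = (T u - \<nu> *\<^sub>C u) - c *\<^sub>C (T (v m) - l m *\<^sub>C v m)"
      using split True by simp
    ultimately have "T u' - \<nu> *\<^sub>C u' \<in> W \<nu>"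
      using Suc.prems(3) by (simp add: W_def span_diff)
    then have "u' \<in> W \<nu>" using Suc.IH[of u'] c Suc.prems(1) by (simp add: u'_def)
    then show ?thesis using vm unfolding u by (simp add: W_def span_add span_scale)
  next
    case False
    let ?R = "span (v ` {..<n} - {v m})"
    have sub1: "span (v ` {..<m}) \<subseteq> ?R"
      using inj Suc.prems(1) by (intro span_mono) (auto dest: inj_onD)
    have sub2: "W \<nu> \<subseteq> ?R"
      using inj Suc.prems(1) False unfolding W_def by (intro span_mono) (auto dest: inj_onD)
    have "T u' \<in> span (v ` {..<m})"
      using adapted_chain_invariant[OF T ch, of m u'] c Suc.prems(1) by (simp add: u'_def)
    then have "T u' - \<nu> *\<^sub>C u' \<in> ?R"
      using c sub1 by (auto simp: u'_def intro: span_diff span_scale)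
    moreover have "c *\<^sub>C (T (v m) - l m *\<^sub>C v m) \<in> ?R"
      using adapted_chain_nilpart[OF ch, of m m] Suc.prems(1) sub1 by (auto intro: span_scale)
    moreover have "T u - \<nu> *\<^sub>C u \<in> ?R" using Suc.prems(3) sub2 by auto
    moreover have "(c * (l m - \<nu>)) *\<^sub>C v m =
        (T u - \<nu> *\<^sub>C u) - ((T u' - \<nu> *\<^sub>C u') + c *\<^sub>C (T (v m) - l m *\<^sub>C v m))"
      using split by (metis add_diff_cancel_left')
    ultimately have vm: "(c * (l m - \<nu>)) *\<^sub>C v m \<in> ?R"
      by (metis span_diff span_add)
    have "c * (l m - \<nu>) = 0"
    proof (rule ccontr)
      assume nz: "c * (l m - \<nu>) \<noteq> 0"
      then have "v m \<in> ?R"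
        using span_scale[OF vm, of "inverse (c * (l m - \<nu>))"]
        by (simp only: scaleC_scaleC left_inverse[OF nz] scaleC_one)
      moreover have "v m \<in> v ` {..<n}" using Suc.prems(1) by auto
      ultimately show False using ind by (auto simp: dependent_def)
    qed
    then have "u' = u" using False by (simp add: u'_def)
    with c have "u \<in> span (v ` {..<m})" by (simp only: u'_def)
    then show ?thesis using Suc.IH[of u] Suc.prems by simp
  qed
qed

lemma adapted_chain_nilpotent:
  assumes T: "clinear T" and ch: "adapted_chain T n v l" and l: "\<And>i. i < n \<Longrightarrow> l i = 0"
  shows "m \<le> n \<Longrightarrow> u \<in> span (v ` {..<m}) \<Longrightarrow> (T ^^ m) u = 0"
proof (induction m arbitrary: u)
  case 0
  then show ?case by simp
next
  case (Suc m)
  have "T u \<in> span (v ` {..<m})"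
    using Suc.prems(2)
  proof (induction rule: span_induct_alt)
    case base
    show ?case by (simp add: clinear_zero[OF T] span_zero)
  next
    case (step c x y)
    then obtain i where i: "i < Suc m" "x = v i" by auto
    have "T x \<in> span (v ` {..<m})"
      using adapted_chain_nilpart[OF ch, of i m] l[of i] i Suc.prems(1) by simp
    with step.IH show ?case
      by (simp add: clinear_add[OF T] clinear_scaleC[OF T] span_add span_scale)
  qed
  with Suc have "(T ^^ m) (T u) = 0" by simp
  then show ?case by (simp only: funpow_Suc_right o_apply)
qed

text \<open>The operator that is multiplication by \<open>cnj \<nu>\<close> on the generalized eigenspace of \<open>\<nu>\<close>. Its product
  with \<open>T\<close> is triangular with diagonal entries \<open>|l i|\<^sup>2\<close>, so that the trace of the product detects
  whether \<open>T\<close> has a nonzero eigenvalue.\<close>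
lemma conjugate_operator:
  assumes T: "clinear T" and ch: "adapted_chain T n v l" and full: "span (v ` {..<n}) = UNIV"
  obtains D where "clinear D"
    "\<And>\<nu> u. u \<in> span (v ` {k. k < n \<and> l k = \<nu>}) \<Longrightarrow> D u = cnj \<nu> *\<^sub>C u"
    "trace (\<lambda>u. T (D u)) = (\<Sum>i<n. l i * cnj (l i))"
proof -
  have inj: "inj_on v {..<n}" and ind: "independent (v ` {..<n})"
    using independent_sequence[of n v] ch by (auto simp: adapted_chain_def)
  let ?c = "\<lambda>u i. representation (v ` {..<n}) u (v i)"
  have c: "clinear (\<lambda>u. ?c u i)" for i
    by (rule clinear_representation[OF ind full])
  have c_basis: "?c (v j) i = (if i = j then 1 else 0)" if "i < n" "j < n" for i j
    using that inj by (auto simp: representation_basis[OF ind] inj_on_eq_iff)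
  have c_low: "?c s i = 0" if "i < n" "s \<in> span (v ` {..<i})" for s i
    using that(2)
  proof (induction rule: span_induct_alt)
    case base
    show ?case by (rule clinear_zero[OF c])
  next
    case (step a x y)
    then show ?case
      using c_basis that(1) by (auto simp: clinear_add[OF c] clinear_scaleC[OF c] scaleC_complex_def)
  qed
  define D where "D u = (\<Sum>i<n. (?c u i * cnj (l i)) *\<^sub>C v i)" for u
  have D: "clinear D"
    by (rule clinearI) (simp_all add: D_def clinear_add[OF c] clinear_scaleC[OF c] scaleC_complex_def
        distrib_right scale_left_distrib sum.distrib scale_sum_right mult.assoc)
  have D_basis: "D (v j) = cnj (l j) *\<^sub>C v j" if "j < n" for j
  proof -
    have "D (v j) = (\<Sum>i\<in>{j}. cnj (l i) *\<^sub>C v i)"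
      unfolding D_def by (rule sum.mono_neutral_cong_right) (use that in \<open>auto simp: c_basis\<close>)
    then show ?thesis by simp
  qed
  have D_eigen: "D u = cnj \<nu> *\<^sub>C u" if "u \<in> span (v ` {k. k < n \<and> l k = \<nu>})" for u \<nu>
    using that
  proof (induction rule: span_induct_alt)
    case base
    show ?case by (simp add: clinear_zero[OF D])
  next
    case (step a x y)
    then show ?case
      by (auto simp: clinear_add[OF D] clinear_scaleC[OF D] D_basis scale_right_distrib mult.commute)
  qed
  have "trace (\<lambda>u. T (D u)) = (\<Sum>b\<in>v ` {..<n}. representation (v ` {..<n}) (T (D b)) b)"
    by (rule trace_basis[OF ind full clinear_compose[OF T D]])
  also have "\<dots> = (\<Sum>i<n. ?c (T (D (v i))) i)"
    by (simp add: sum.reindex[OF inj])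
  also have "\<dots> = (\<Sum>i<n. l i * cnj (l i))"
  proof (rule sum.cong[OF refl])
    fix i assume "i \<in> {..<n}"
    then have i: "i < n" by simp
    have "?c (T (v i)) i = ?c (T (v i) - l i *\<^sub>C v i) i + ?c (l i *\<^sub>C v i) i"
      by (simp add: clinear_diff[OF c])
    also have "\<dots> = l i"
      using c_low[OF i adapted_chain_nilpart[OF ch i order_refl]] i
      by (simp add: clinear_scaleC[OF c] c_basis scaleC_complex_def)
    finally show "?c (T (D (v i))) i = l i * cnj (l i)"
      using i by (simp add: D_basis clinear_scaleC[OF T] clinear_scaleC[OF c] scaleC_complex_def)
  qed
  finally show ?thesis using that D D_eigen by blast
qed

end

section \<open>Lie algebras\<close>

context lie_algebra
begin

lemma clinear_ad: "clinear (bracket x)"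
  and clinear_bracket_left: "clinear (\<lambda>x. bracket x y)"
  using cbilinear_bracket by (auto simp: cbilinear_def)

lemmas bracket_simps =
  clinear_add[OF clinear_ad] clinear_add[OF clinear_bracket_left]
  clinear_scaleC[OF clinear_ad] clinear_scaleC[OF clinear_bracket_left]
  clinear_diff[OF clinear_ad] clinear_diff[OF clinear_bracket_left]
  clinear_zero[OF clinear_ad] clinear_zero[OF clinear_bracket_left]

lemma bracket_antisym: "bracket x y = - bracket y x"
proof -
  have "bracket (x + y) (x + y) = 0" by (rule bracket_self)
  then have "bracket x y + bracket y x = 0"
    by (simp add: bracket_simps bracket_self[of x] bracket_self[of y] add.commute)
  then show ?thesis by (simp add: eq_neg_iff_add_eq_0)
qed

lemma bracket_minus: "bracket x (- y) = - bracket x y" "bracket (- x) y = - bracket x y"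
  using bracket_simps(5)[of x 0 y] bracket_simps(6)[of 0 x y] by (simp_all add: bracket_simps)

lemma bracket_derivation: "bracket x (bracket y z) = bracket (bracket x y) z + bracket y (bracket x z)"
proof -
  have "bracket y (bracket z x) = - bracket y (bracket x z)"
    using bracket_antisym[of z x] by (simp add: bracket_minus)
  moreover have "bracket z (bracket x y) = - bracket (bracket x y) z"
    by (rule bracket_antisym)
  ultimately show ?thesis
    using jacobi[of x y z] by (simp add: algebra_simps)
qed

lemma ad_bracket: "bracket (bracket x y) z = bracket x (bracket y z) - bracket y (bracket x z)"
  by (simp add: bracket_derivation[of x])

end

locale fin_dim_lie_algebra = lie_algebra bracket + fin_dim_complex Basis
  for bracket :: "'a::complex_vector \<Rightarrow> 'a \<Rightarrow> 'a" and Basis :: "'a set"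
begin

section \<open>Engel's theorem\<close>

text \<open>The conclusion of Engel's theorem for \<open>K\<close> acting on any subquotient \<open>W / U\<close> of the adjoint
  representation: a nonzero element of \<open>W / U\<close> is annihilated by \<open>K\<close>. The subquotients are
  described by pairs of invariant subspaces.\<close>
definition acts_nilpotently :: "'a set \<Rightarrow> bool"
  where "acts_nilpotently K \<longleftrightarrow> (\<forall>(U :: 'a set) W. subspace U \<and> subspace W \<and> U \<subset> W
    \<and> (\<forall>k\<in>K. bracket k ` U \<subseteq> U) \<and> (\<forall>k\<in>K. bracket k ` W \<subseteq> W)
    \<longrightarrow> (\<exists>w\<in>W - U. \<forall>k\<in>K. bracket k w \<in> U))"

lemma subspace_transporter: "subspace U \<Longrightarrow> subspace {k. bracket k w \<in> U}"
  by (auto simp: subspace_def bracket_simps)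

text \<open>The elements of \<open>W\<close> that \<open>K\<close> maps into \<open>U\<close> are stable under \<open>y\<close>, because \<open>y\<close> normalizes \<open>K\<close>.
  Starting from one of them outside \<open>U\<close>, the last iterate under the nilpotent \<open>ad y\<close> that is not
  yet in \<open>U\<close> is mapped into \<open>U\<close> by \<open>y\<close> as well.\<close>
lemma acts_nilpotently_insert:
  assumes K: "acts_nilpotently K" and norm: "\<And>k. k \<in> K \<Longrightarrow> bracket k y \<in> K"
    and nil: "\<And>u. \<exists>n. (bracket y ^^ n) u = 0"
  shows "acts_nilpotently (span (insert y K))"
  unfolding acts_nilpotently_def
proof (intro allI impI, elim conjE)
  fix U W :: "'a set"
  assume U: "subspace U" and W: "subspace W" and UW: "U \<subset> W"
    and KU: "\<forall>k\<in>span (insert y K). bracket k ` U \<subseteq> U"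
    and KW: "\<forall>k\<in>span (insert y K). bracket k ` W \<subseteq> W"
  have sp: "k \<in> span (insert y K)" if "k = y \<or> k \<in> K" for k
    using that by (intro span_base) auto
  obtain w where w: "w \<in> W - U" "\<forall>k\<in>K. bracket k w \<in> U"
    using K U W UW KU KW sp unfolding acts_nilpotently_def by meson
  have inv: "(bracket y ^^ n) w \<in> W \<and> (\<forall>k\<in>K. bracket k ((bracket y ^^ n) w) \<in> U)" for n
  proof (induction n)
    case 0
    show ?case using w by simp
  next
    case (Suc n)
    let ?u = "(bracket y ^^ n) w"
    have "bracket k (bracket y ?u) \<in> U" if "k \<in> K" for k
    proof -
      have "bracket (bracket k y) ?u \<in> U" using Suc norm that by blast
      moreover have "bracket y (bracket k ?u) \<in> U" using Suc KU sp that by blast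
      ultimately show ?thesis
        unfolding bracket_derivation[of k y] by (rule subspace_add[OF U])
    qed
    moreover have "bracket y ?u \<in> W" using Suc KW sp by blast
    ultimately show ?case by simp
  qed
  define n where "n = (LEAST n. (bracket y ^^ n) w \<in> U)"
  obtain m where "(bracket y ^^ m) w = 0" using nil by blast
  then have "(bracket y ^^ m) w \<in> U" using subspace_0[OF U] by simp
  then have n: "(bracket y ^^ n) w \<in> U" unfolding n_def by (rule LeastI)
  with w obtain p where p: "n = Suc p" by (cases n) auto
  let ?w = "(bracket y ^^ p) w"
  have "?w \<notin> U" using not_less_Least[of p "\<lambda>n. (bracket y ^^ n) w \<in> U"] p by (simp add: n_def)
  moreover have "span (insert y K) \<subseteq> {k. bracket k ?w \<in> U}"
    using inv[of p] n p by (intro span_minimal subspace_transporter U) auto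
  ultimately show "\<exists>w\<in>W - U. \<forall>k\<in>span (insert y K). bracket k w \<in> U"
    using inv[of p] by blast
qed

text \<open>A subalgebra \<open>K\<close> of maximal dimension among those that act nilpotently must be the whole algebra:
  otherwise the property of \<open>K\<close> applied to the subquotient of the whole space by \<open>K\<close> yields an
  element outside \<open>K\<close> that normalizes \<open>K\<close>, and adjoining it gives a larger such subalgebra. For the
  whole algebra, the property applied to the full adjoint representation is the claim.\<close>
lemma engel_center:
  assumes nil: "\<And>y u. \<exists>n. (bracket y ^^ n) u = 0" and nz: "UNIV \<noteq> {0::'a}"
  shows "\<exists>z. z \<noteq> 0 \<and> (\<forall>x. bracket x z = 0)"
proof -
  define P where "P d \<longleftrightarrow> (\<exists>K. subspace K \<and> (\<forall>a\<in>K. \<forall>b\<in>K. bracket a b \<in> K)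
    \<and> acts_nilpotently K \<and> dim K = d)" for d
  have "P 0"
    unfolding P_def acts_nilpotently_def
    by (intro exI[of _ "{0}"]) (auto simp: bracket_simps subspace_0)
  moreover have bound: "P d \<Longrightarrow> d \<le> dimension" for d
    unfolding P_def using dim_subset_UNIV by blast
  ultimately have max: "P (Greatest P)" "\<not> P (Suc (Greatest P))"
    using GreatestI_nat[of P 0 dimension] Greatest_le_nat[of P "Suc (Greatest P)" dimension]
    by (auto simp: Suc_le_eq)
  then obtain K where K: "subspace K" "\<And>a b. a \<in> K \<Longrightarrow> b \<in> K \<Longrightarrow> bracket a b \<in> K"
    "acts_nilpotently K" "dim K = Greatest P"
    unfolding P_def by blast
  have "K = UNIV"
  proof (rule ccontr)
    assume "K \<noteq> UNIV"
    then have "\<exists>w\<in>UNIV - K. \<forall>k\<in>K. bracket k w \<in> K"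
      using K by (intro K(3)[unfolded acts_nilpotently_def, rule_format]) auto
    then obtain y where y: "y \<notin> K" "\<And>k. k \<in> K \<Longrightarrow> bracket k y \<in> K" by auto
    let ?K = "span (insert y K)"
    have K': "x \<in> ?K \<longleftrightarrow> (\<exists>c. x - c *\<^sub>C y \<in> K)" for x
      using K(1) by (simp add: span_breakdown_eq span_eq_iff[THEN iffD2])
    have "bracket a b \<in> ?K" if "a \<in> ?K" "b \<in> ?K" for a b
    proof -
      from that obtain c d where c: "a - c *\<^sub>C y \<in> K" and d: "b - d *\<^sub>C y \<in> K" by (auto simp: K')
      define a' b' where "a' = a - c *\<^sub>C y" and "b' = b - d *\<^sub>C y"
      have ab: "a = a' + c *\<^sub>C y" "b = b' + d *\<^sub>C y" by (simp_all add: a'_def b'_def)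
      have "bracket a b = bracket a' b' + d *\<^sub>C bracket a' y - c *\<^sub>C bracket b' y"
        unfolding ab using bracket_antisym[of y b'] by (simp add: bracket_simps bracket_self)
      also have "\<dots> \<in> K"
        using c d y K by (auto simp: a'_def[symmetric] b'_def[symmetric]
            intro!: subspace_add subspace_diff subspace_scale)
      finally show ?thesis using span_superset[of "insert y K"] by auto
    qed
    moreover have "acts_nilpotently ?K"
      by (rule acts_nilpotently_insert[OF K(3) y(2) nil])
    moreover have "dim ?K = Suc (Greatest P)"
      using y K by (simp add: dim_insert span_eq_iff[THEN iffD2])
    ultimately have "P (Suc (Greatest P))"
      unfolding P_def using subspace_span by blast
    with max show False by simp
  qed
  with K(3) have "\<exists>w\<in>UNIV - {0}. \<forall>k\<in>UNIV. bracket k w \<in> {0}"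
    using nz by (intro K(3)[unfolded acts_nilpotently_def \<open>K = UNIV\<close>, rule_format])
      (auto simp: bracket_simps)
  then show ?thesis by auto
qed


section \<open>The Killing form\<close>

definition killing :: "'a \<Rightarrow> 'a \<Rightarrow> complex"
  where "killing x y = trace (\<lambda>z. bracket x (bracket y z))"

lemma cbilinear_killing: "cbilinear killing"
  unfolding cbilinear_def
  by (intro conjI allI clinearI)
     (simp_all add: killing_def bracket_simps trace_add trace_scale scaleC_complex_def)

lemma killing_sym: "killing x y = killing y x"
  unfolding killing_def by (rule trace_commute[OF clinear_ad clinear_ad])

lemma killing_add_left: "killing (x + y) z = killing x z + killing y z"
  and killing_add_right: "killing z (x + y) = killing z x + killing z y"
  and killing_scale_left: "killing (c *\<^sub>C x) z = c * killing x z"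
  and killing_scale_right: "killing z (c *\<^sub>C x) = c * killing z x"
  and killing_zero_left: "killing 0 z = 0"
  and killing_minus_left: "killing (- x) z = - killing x z"
  and killing_minus_right: "killing z (- x) = - killing z x"
  and killing_diff_left: "killing (x - y) z = killing x z - killing y z"
proof -
  have c: "clinear (killing z)" "clinear (\<lambda>x. killing x z)" for z
    using cbilinear_killing by (auto simp: cbilinear_def)
  show "killing (x + y) z = killing x z + killing y z" "killing z (x + y) = killing z x + killing z y"
    "killing (c *\<^sub>C x) z = c * killing x z" "killing z (c *\<^sub>C x) = c * killing z x"
    and z: "killing 0 z = 0"
    and d: "killing (x - y) z = killing x z - killing y z"
    for x y z c
    using c[of z] by (simp_all add: clinear_add[OF c(1)] clinear_scaleC[OF c(1)] clinear_add[OF c(2)]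
        clinear_scaleC[OF c(2)] clinear_zero[OF c(2)] clinear_diff[OF c(2)] scaleC_complex_def)
  show m: "killing (- x) z = - killing x z" for x z
    using d[of 0 x z] z[of z] by simp
  show "killing z (- x) = - killing z x"
    using m[of x z] by (simp add: killing_sym[of z])
qed

lemma killing_sum_left: "killing (\<Sum>i\<in>A. f i) z = (\<Sum>i\<in>A. killing (f i) z)"
  by (induction A rule: infinite_finite_induct) (simp_all add: killing_add_left killing_zero_left)

lemma killing_sum_right: "killing z (\<Sum>i\<in>A. f i) = (\<Sum>i\<in>A. killing z (f i))"
  by (simp add: killing_sym[of z] killing_sum_left)

text \<open>Written out as traces, both sides contain \<open>tr (ad x ad y ad z)\<close>; the remaining terms
  \<open>tr (ad y ad x ad z)\<close> and \<open>tr (ad x ad z ad y)\<close> agree by cyclicity.\<close>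
lemma killing_invariant: "killing (bracket x y) z = killing x (bracket y z)"
proof -
  have "trace (\<lambda>u. bracket y (bracket x (bracket z u))) = trace (\<lambda>u. bracket x (bracket z (bracket y u)))"
    by (rule trace_commute[OF clinear_ad clinear_compose[OF clinear_ad clinear_ad]])
  then show ?thesis
    by (simp add: killing_def ad_bracket trace_diff bracket_simps)
qed


section \<open>Cartan's criterion\<close>

text \<open>Let \<open>L\<^sub>\<lambda>\<close> denote the generalized eigenspaces of \<open>ad x\<close>. Since \<open>ad x\<close> is a derivation,
  \<open>[L\<^sub>\<lambda>, L\<^sub>\<mu>]\<close> is contained in the generalized eigenspace of \<open>\<lambda> + \<mu>\<close>; and since complex
  conjugation is additive, the operator that acts as \<open>cnj \<lambda>\<close> on each \<open>L\<^sub>\<lambda>\<close> is a derivation, too.\<close>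
lemma conjugate_derivation:
  obtains n v l D where "adapted_chain (bracket x) n v l" "span (v ` {..<n}) = UNIV" "clinear D"
    "\<And>a b. D (bracket a b) = bracket (D a) b + bracket a (D b)"
    "trace (\<lambda>u. bracket x (D u)) = (\<Sum>i<n. l i * cnj (l i))"
proof -
  let ?T = "bracket x"
  obtain n v l where ch: "adapted_chain ?T n v l" and full: "span (v ` {..<n}) = UNIV"
    by (rule ex_full_adapted_chain[OF clinear_ad])
  obtain D where D: "clinear D"
    "\<And>\<nu> u. u \<in> span (v ` {k. k < n \<and> l k = \<nu>}) \<Longrightarrow> D u = cnj \<nu> *\<^sub>C u"
    "trace (\<lambda>u. ?T (D u)) = (\<Sum>i<n. l i * cnj (l i))"
    using conjugate_operator[OF clinear_ad ch full] by blast
  let ?W = "\<lambda>\<nu>. span (v ` {k. k < n \<and> l k = \<nu>})"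
  have D_basis: "D (v i) = cnj (l i) *\<^sub>C v i" if "i < n" for i
    using that by (intro D(2) span_base) auto
  \<comment> \<open>Induction on \<open>i + j\<close>: by the derivation rule, applying \<open>T\<close> minus \<open>l i + l j\<close> replaces one factor
    of the bracket by a combination of earlier chain vectors of the same eigenvalue.\<close>
  have weights: "bracket (v i) (v j) \<in> ?W (l i + l j)" if "i < n" "j < n" for i j
    using that
  proof (induction "i + j" arbitrary: i j rule: less_induct)
    case less
    let ?d = "\<lambda>i. ?T (v i) - l i *\<^sub>C v i"
    let ?P = "\<lambda>i. span (v ` {k. k < i \<and> l k = l i})"
    have d: "?d k \<in> ?P k" if "k < n" for k
      using ch that by (auto simp: adapted_chain_def)
    have "?P i \<subseteq> {a. bracket a (v j) \<in> ?W (l i + l j)}"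
    proof (rule span_minimal)
      show "subspace {a. bracket a (v j) \<in> ?W (l i + l j)}"
        by (rule subspace_transporter) simp
      have "bracket (v k) (v j) \<in> ?W (l i + l j)" if "k < i" "l k = l i" for k
        using less.hyps[of k j] less.prems that by simp
      then show "v ` {k. k < i \<and> l k = l i} \<subseteq> {a. bracket a (v j) \<in> ?W (l i + l j)}" by auto
    qed
    then have 1: "bracket (?d i) (v j) \<in> ?W (l i + l j)"
      using d[OF less.prems(1)] by auto
    have "?P j \<subseteq> {a. bracket a (v i) \<in> ?W (l i + l j)}"
    proof (rule span_minimal)
      show "subspace {a. bracket a (v i) \<in> ?W (l i + l j)}"
        by (rule subspace_transporter) simp
      have "bracket (v k) (v i) \<in> ?W (l i + l j)" if "k < j" "l k = l j" for k
        using less.hyps[of i k] less.prems that span_neg[of "bracket (v i) (v k)"]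
        by (simp add: bracket_antisym[of "v k" "v i"])
      then show "v ` {k. k < j \<and> l k = l j} \<subseteq> {a. bracket a (v i) \<in> ?W (l i + l j)}" by auto
    qed
    then have "bracket (?d j) (v i) \<in> ?W (l i + l j)"
      using d[OF less.prems(2)] by auto
    then have 2: "bracket (v i) (?d j) \<in> ?W (l i + l j)"
      unfolding bracket_antisym[of "v i"] by (rule span_neg)
    have "?T (bracket (v i) (v j)) - (l i + l j) *\<^sub>C bracket (v i) (v j)
        = bracket (?d i) (v j) + bracket (v i) (?d j)"
      by (simp add: bracket_derivation[of x] bracket_simps scale_left_distrib)
    also have "\<dots> \<in> ?W (l i + l j)" using 1 2 by (rule span_add)
    finally show ?case
      using adapted_chain_eigen_closed[OF clinear_ad ch order_refl,
          of "bracket (v i) (v j)" "l i + l j"] full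
      by simp
  qed
  let ?R = "\<lambda>a. {b. D (bracket a b) = bracket (D a) b + bracket a (D b)}"
  have R: "subspace (?R a)" for a
    by (auto simp: subspace_def bracket_simps clinear_add[OF D(1)] clinear_scaleC[OF D(1)]
        clinear_zero[OF D(1)] scale_right_distrib)
  have basis: "v j \<in> ?R (v i)" if "i < n" "j < n" for i j
    using that D(2)[OF weights[OF that]] by (simp add: D_basis bracket_simps scale_left_distrib)
  have half: "b \<in> ?R (v i)" if "i < n" for i b
    using span_minimal[OF _ R, of "v ` {..<n}" "v i"] basis that full by auto
  have "v i \<in> ?R b" if "i < n" for i b
  proof -
    have "D (bracket b (v i)) = - D (bracket (v i) b)"
      unfolding bracket_antisym[of b] using clinear_diff[OF D(1), of 0] by (simp add: clinear_zero[OF D(1)])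
    also have "\<dots> = bracket (D b) (v i) + bracket b (D (v i))"
      using half[OF that, of b] bracket_antisym[of b "D (v i)"] bracket_antisym[of "D b" "v i"] by simp
    finally show ?thesis by simp
  qed
  then have "D (bracket a b) = bracket (D a) b + bracket a (D b)" for a b
    using span_minimal[OF _ R, of "v ` {..<n}" a] full by auto
  with that ch full D show ?thesis by blast
qed

text \<open>For the conjugate derivation \<open>D\<close> of \<open>x\<close>, cyclicity of the trace gives
  \<open>tr (ad [a, b] D) = tr (ad a [ad b, D]) = - tr (ad a ad (D b)) = - killing a (D b) = 0\<close>.
  As brackets span the algebra, also \<open>tr (ad x D) = 0\<close>. But this trace is the sum of the
  \<open>|\<lambda>|\<^sup>2\<close> over the eigenvalues of \<open>ad x\<close>, which therefore all vanish.\<close>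
lemma ad_nilpotent_of_killing_zero:
  assumes perfect: "span {bracket a b | a b. True} = UNIV" and zero: "\<And>a b. killing a b = 0"
  shows "\<exists>n. (bracket x ^^ n) u = 0"
proof -
  obtain n v l D where ch: "adapted_chain (bracket x) n v l" and full: "span (v ` {..<n}) = UNIV"
    and D: "clinear D" "\<And>a b. D (bracket a b) = bracket (D a) b + bracket a (D b)"
    "trace (\<lambda>u. bracket x (D u)) = (\<Sum>i<n. l i * cnj (l i))"
    by (rule conjugate_derivation[of x]) blast
  have "trace (\<lambda>u. bracket (bracket a b) (D u)) = 0" for a b
  proof -
    have "trace (\<lambda>u. bracket b (bracket a (D u))) = trace (\<lambda>u. bracket a (D (bracket b u)))"
      by (rule trace_commute[OF clinear_ad clinear_compose[OF clinear_ad D(1)]])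
    then have "trace (\<lambda>u. bracket (bracket a b) (D u)) = - killing a (D b)"
      by (simp add: ad_bracket trace_diff D(2) bracket_simps trace_add killing_def)
    then show ?thesis by (simp add: zero)
  qed
  then have "span {bracket a b | a b. True} \<subseteq> {z. trace (\<lambda>u. bracket z (D u)) = 0}"
    by (intro span_minimal) (auto simp: subspace_def bracket_simps trace_add trace_scale
        trace_def[of "\<lambda>_. 0"] representation_zero)
  moreover have "x \<in> span {bracket a b | a b. True}"
    unfolding perfect by simp
  ultimately have "trace (\<lambda>u. bracket x (D u)) = 0" by blast
  then have "(\<Sum>i<n. l i * cnj (l i)) = 0" by (simp only: D(3))
  then have "of_real (\<Sum>i<n. (cmod (l i))\<^sup>2) = (0::complex)"
    by (simp only: of_real_sum complex_norm_square)
  then have "(\<Sum>i<n. (cmod (l i))\<^sup>2) = 0" by (simp only: of_real_eq_0_iff)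
  then have "l i = 0" if "i < n" for i
    using that by (simp add: sum_nonneg_eq_0_iff)
  then show ?thesis
    using adapted_chain_nilpotent[OF clinear_ad ch, of n u] full by auto
qed

end


section \<open>Nondegeneracy of the Killing form\<close>

locale fin_dim_simple_lie_algebra = fin_dim_lie_algebra bracket Basis + simple_lie_algebra bracket
  for bracket :: "'a::complex_vector \<Rightarrow> 'a \<Rightarrow> 'a" and Basis :: "'a set"
begin

lemma perfect: "span {bracket a b | a b. True} = UNIV"
proof -
  let ?I = "span {bracket a b | a b. True}"
  have br: "bracket x y \<in> ?I" for x y
    by (rule span_base) blast
  then have "lie_ideal ?I"
    unfolding lie_ideal_def by simp
  then have "?I = {0} \<or> ?I = UNIV"
    by (rule ideal_trivial)
  with br nonabelian show ?thesis
    by (metis singletonD)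
qed

lemma center_trivial: "(\<And>x. bracket x z = 0) \<Longrightarrow> z = 0"
proof -
  assume z: "\<And>x. bracket x z = 0"
  let ?Z = "{z. \<forall>x. bracket x z = 0}"
  have "lie_ideal ?Z"
    unfolding lie_ideal_def by (auto simp: subspace_def bracket_simps)
  then have "?Z = {0} \<or> ?Z = UNIV"
    by (rule ideal_trivial)
  moreover have "?Z \<noteq> UNIV" using nonabelian by auto
  ultimately show ?thesis using z by blast
qed

text \<open>The radical of the Killing form is an ideal. If it were everything, Cartan's criterion would make
  every \<open>ad y\<close> nilpotent, and Engel's theorem would provide a nonzero central element.\<close>
lemma killing_nondegenerate:
  assumes "\<And>v. killing u v = 0"
  shows "u = 0"
proof -
  let ?R = "{u. \<forall>v. killing u v = 0}"
  have "killing (bracket x u) v = 0" if "\<forall>v. killing u v = 0" for x u v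
    using that killing_invariant[of u x v]
    by (simp add: bracket_antisym[of x u] killing_minus_left)
  then have "lie_ideal ?R"
    unfolding lie_ideal_def
    by (auto simp: subspace_def killing_add_left killing_scale_left killing_zero_left)
  then have R: "?R = {0} \<or> ?R = UNIV"
    by (rule ideal_trivial)
  have "?R \<noteq> UNIV"
  proof
    assume "?R = UNIV"
    then have "killing a b = 0" for a b by blast
    then have nil: "\<exists>n. (bracket y ^^ n) u = 0" for y u
      by (rule ad_nilpotent_of_killing_zero[OF perfect])
    have "UNIV \<noteq> {0::'a}"
      using nonabelian by (metis UNIV_I singletonD)
    then show False
      using engel_center[OF nil] center_trivial by blast
  qed
  with R assms show ?thesis by blast
qed


section \<open>Dual bases\<close>

text \<open>By nondegeneracy, the map sending \<open>u\<close> to the vector with the coordinates \<open>killing b u\<close> is injective,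
  hence surjective.\<close>
lemma ex_dual_vector: "\<exists>u. \<forall>b\<in>Basis. killing b u = (if b = c then 1 else 0)"
proof -
  define F where "F u = (\<Sum>b\<in>Basis. killing b u *\<^sub>C b)" for u
  have F: "clinear F"
    by (rule clinearI) (simp_all add: F_def killing_add_right killing_scale_right scale_left_distrib
        sum.distrib scale_sum_right)
  have rep_sum: "representation Basis (\<Sum>b\<in>Basis. f b *\<^sub>C b) b = f b" if "b \<in> Basis" for f b
  proof -
    note lin = clinear_representation[OF independent_Basis span_Basis]
    have "representation Basis (\<Sum>b\<in>Basis. f b *\<^sub>C b) b = (\<Sum>a\<in>Basis. if a = b then f a else 0)"
      unfolding clinear_sum[OF lin] clinear_scaleC[OF lin]
      by (intro sum.cong) (auto simp: representation_basis[OF independent_Basis] scaleC_complex_def)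
    then show ?thesis using that finite_Basis by simp
  qed
  have "inj F"
  proof (rule injI)
    fix u v assume "F u = F v"
    then have eq: "killing b u = killing b v" if "b \<in> Basis" for b
      using rep_sum[OF that, of "\<lambda>b. killing b u"] rep_sum[OF that, of "\<lambda>b. killing b v"]
      by (simp add: F_def)
    have "killing (u - v) w = 0" for w
    proof -
      have "killing u w = killing v w"
        using eq by (subst (1 2) sum_representation[OF independent_Basis span_Basis, of w, symmetric])
          (simp add: killing_sum_right killing_scale_right killing_sym[of _ u] killing_sym[of _ v])
      then show ?thesis by (simp add: killing_diff_left)
    qed
    then show "u = v" using killing_nondegenerate[of "u - v"] by simp
  qed
  then obtain u where u: "F u = c"
    using linear_inj_imp_surj[OF F] by (metis surjD)
  show ?thesis
  proof (cases "c \<in> Basis")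
    case True
    have "killing b u = (if b = c then 1 else 0)" if "b \<in> Basis" for b
      using rep_sum[OF that, of "\<lambda>b. killing b u"] u
        representation_basis[OF independent_Basis True]
      by (simp add: F_def)
    then show ?thesis by blast
  next
    case False
    then show ?thesis
      by (intro exI[of _ 0]) (auto simp: killing_zero_left killing_sym[of _ 0])
  qed
qed

text \<open>The equations determine \<open>dual c\<close> also for \<open>c\<close> outside the basis, where they force it to be
  zero.\<close>
definition dual :: "'a \<Rightarrow> 'a"
  where "dual c = (SOME u. \<forall>b\<in>Basis. killing b u = (if b = c then 1 else 0))"

lemma killing_dual: "b \<in> Basis \<Longrightarrow> killing b (dual c) = (if b = c then 1 else 0)"
  using someI_ex[OF ex_dual_vector[of c]] by (auto simp: dual_def)

lemma representation_dual:
  assumes "b \<in> Basis"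
  shows "representation Basis u b = killing u (dual b)"
proof -
  have "killing u (dual b) = (\<Sum>a\<in>Basis. representation Basis u a * killing a (dual b))"
    by (subst sum_representation[OF independent_Basis span_Basis, of u, symmetric])
       (simp only: killing_sum_left killing_scale_left)
  also have "\<dots> = (\<Sum>a\<in>Basis. if a = b then representation Basis u a else 0)"
    by (intro sum.cong) (auto simp: killing_dual)
  finally show ?thesis using assms finite_Basis by simp
qed

lemma basis_expansion: "u = (\<Sum>b\<in>Basis. killing u (dual b) *\<^sub>C b)"
  using sum_representation[OF independent_Basis span_Basis, of u]
  by (simp add: representation_dual)

lemma dual_expansion: "u = (\<Sum>b\<in>Basis. killing u b *\<^sub>C dual b)"
proof -
  have "killing (u - (\<Sum>b\<in>Basis. killing u b *\<^sub>C dual b)) v = 0" for v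
  proof -
    have "killing u v = (\<Sum>b\<in>Basis. killing v (dual b) * killing u b)"
      by (subst basis_expansion[of v]) (simp only: killing_sum_right killing_scale_right)
    then show ?thesis
      by (simp add: killing_diff_left killing_sum_left killing_scale_left killing_sym[of "dual _"]
          mult.commute)
  qed
  then show ?thesis
    using killing_nondegenerate by (metis eq_iff_diff_eq_0)
qed

lemma trace_dual: "trace f = (\<Sum>b\<in>Basis. killing (f b) (dual b))"
  by (simp add: trace_def representation_dual)


section \<open>The cobracket\<close>

text \<open>Up to sign, the transpose of the bracket when \<open>L\<close> is identified with its dual by the Killing form.
  This particular formula makes the composition with the bracket a Casimir operator.\<close>
definition cobracket :: "'a \<Rightarrow> ('a, 'a) tensor"
  where "cobracket x = (\<Sum>b\<in>Basis. bracket x b \<otimes>\<^sub>C dual b)"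

lemma clinear_pure_tensor: "clinear (\<lambda>x. x \<otimes>\<^sub>C y)" "clinear (\<lambda>y. x \<otimes>\<^sub>C y)"
  by (auto intro!: clinearI simp: pure_tensor_simps)

lemma clinear_cobracket: "clinear cobracket"
  by (rule clinearI) (simp_all add: cobracket_def bracket_simps pure_tensor_simps sum.distrib
      complex_vector.scale_sum_right)

text \<open>In the dual basis the coefficients are those of the transposed bracket; the coalgebra axioms
  become the corresponding identities for the bracket inside the second argument of the Killing
  form.\<close>
lemma cobracket_coordinates:
  "cobracket x = (\<Sum>b\<in>Basis. \<Sum>c\<in>Basis. killing x (bracket b c) *\<^sub>C (dual c \<otimes>\<^sub>C dual b))"
  unfolding cobracket_def
proof (rule sum.cong[OF refl])
  fix b
  have "bracket x b = (\<Sum>c\<in>Basis. killing x (bracket b c) *\<^sub>C dual c)"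
    by (subst dual_expansion) (simp only: killing_invariant)
  then show "bracket x b \<otimes>\<^sub>C dual b
      = (\<Sum>c\<in>Basis. killing x (bracket b c) *\<^sub>C (dual c \<otimes>\<^sub>C dual b))"
    by (simp add: clinear_sum[OF clinear_pure_tensor(1)] pure_tensor_simps)
qed

lemma cobracket_antisymmetric: "cobracket x + tensor_flip (cobracket x) = 0"
proof -
  have neg: "killing x (bracket b c) *\<^sub>C t = - (killing x (bracket c b) *\<^sub>C t)"
    for b c and t :: "('a, 'a) tensor"
    using bracket_antisym[of b c] by (simp add: killing_minus_right)
  have "tensor_flip (cobracket x)
      = (\<Sum>b\<in>Basis. \<Sum>c\<in>Basis. killing x (bracket b c) *\<^sub>C (dual b \<otimes>\<^sub>C dual c))"
    by (simp add: cobracket_coordinates clinear_sum[OF clinear_tensor_flip]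
        clinear_scaleC[OF clinear_tensor_flip] tensor_flip_pure)
  also have "\<dots> = (\<Sum>c\<in>Basis. \<Sum>b\<in>Basis. killing x (bracket b c) *\<^sub>C (dual b \<otimes>\<^sub>C dual c))"
    by (rule sum.swap)
  also have "\<dots> = (\<Sum>c\<in>Basis. \<Sum>b\<in>Basis. - (killing x (bracket c b) *\<^sub>C (dual b \<otimes>\<^sub>C dual c)))"
    by (intro sum.cong refl neg)
  also have "\<dots> = - cobracket x"
    by (simp add: cobracket_coordinates sum_negf)
  finally show ?thesis by simp
qed

text \<open>With tensors of third order written by coefficient functions, the cyclic rotation of the
  factors becomes a permutation of arguments.\<close>
definition cubic :: "('a \<Rightarrow> 'a \<Rightarrow> 'a \<Rightarrow> complex) \<Rightarrow> ('a, ('a, 'a) tensor) tensor"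
  where "cubic f = (\<Sum>r\<in>Basis. \<Sum>q\<in>Basis. \<Sum>p\<in>Basis. f p q r *\<^sub>C (dual p \<otimes>\<^sub>C dual q \<otimes>\<^sub>C dual r))"

lemma cubic_add: "cubic f + cubic g = cubic (\<lambda>p q r. f p q r + g p q r)"
  by (simp add: cubic_def complex_vector.scale_left_distrib sum.distrib)

lemma tensor_cycle_cubic: "tensor_cycle (cubic f) = cubic (\<lambda>p q r. f r p q)"
proof -
  have "tensor_cycle (cubic f)
      = (\<Sum>r\<in>Basis. \<Sum>q\<in>Basis. \<Sum>p\<in>Basis. f p q r *\<^sub>C (dual q \<otimes>\<^sub>C dual r \<otimes>\<^sub>C dual p))"
    by (simp add: cubic_def clinear_sum[OF clinear_tensor_cycle]
        clinear_scaleC[OF clinear_tensor_cycle] tensor_cycle_pure)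
  also have "\<dots> = (\<Sum>r\<in>Basis. \<Sum>p\<in>Basis. \<Sum>q\<in>Basis. f p q r *\<^sub>C (dual q \<otimes>\<^sub>C dual r \<otimes>\<^sub>C dual p))"
    by (intro sum.cong refl sum.swap)
  also have "\<dots> = (\<Sum>p\<in>Basis. \<Sum>r\<in>Basis. \<Sum>q\<in>Basis. f p q r *\<^sub>C (dual q \<otimes>\<^sub>C dual r \<otimes>\<^sub>C dual p))"
    by (rule sum.swap)
  finally show ?thesis by (simp add: cubic_def)
qed

lemma cobracket_iterated:
  "tensor_map id cobracket (cobracket x) = cubic (\<lambda>p q r. killing x (bracket (bracket r q) p))"
proof -
  have id: "clinear (id :: 'a \<Rightarrow> 'a)" by (rule clinearI) simp_all
  note lin = clinear_tensor_map[OF id clinear_cobracket]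
  let ?t = "\<lambda>r q. dual q \<otimes>\<^sub>C dual r"
  have "tensor_map id cobracket (cobracket x) = (\<Sum>b\<in>Basis. bracket x b \<otimes>\<^sub>C cobracket (dual b))"
    by (subst cobracket_def)
       (simp add: clinear_sum[OF lin] tensor_map_pure[OF id clinear_cobracket])
  also have "\<dots> = (\<Sum>b\<in>Basis. \<Sum>r\<in>Basis. \<Sum>q\<in>Basis.
      (killing (dual b) (bracket r q) *\<^sub>C bracket x b) \<otimes>\<^sub>C ?t r q)"
    by (simp add: cobracket_coordinates clinear_sum[OF clinear_pure_tensor(2)] pure_tensor_simps)
  also have "\<dots> = (\<Sum>r\<in>Basis. \<Sum>b\<in>Basis. \<Sum>q\<in>Basis.
      (killing (dual b) (bracket r q) *\<^sub>C bracket x b) \<otimes>\<^sub>C ?t r q)"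
    by (rule sum.swap)
  also have "\<dots> = (\<Sum>r\<in>Basis. \<Sum>q\<in>Basis. \<Sum>b\<in>Basis.
      (killing (dual b) (bracket r q) *\<^sub>C bracket x b) \<otimes>\<^sub>C ?t r q)"
    by (intro sum.cong refl sum.swap)
  also have "\<dots> = (\<Sum>r\<in>Basis. \<Sum>q\<in>Basis. bracket x (bracket r q) \<otimes>\<^sub>C ?t r q)"
  proof (intro sum.cong refl)
    fix r q
    have "bracket x (bracket r q) = (\<Sum>b\<in>Basis. killing (dual b) (bracket r q) *\<^sub>C bracket x b)"
      by (subst basis_expansion[of "bracket r q"])
         (simp only: clinear_sum[OF clinear_ad] bracket_simps killing_sym[of "dual _"])
    then show "(\<Sum>b\<in>Basis. (killing (dual b) (bracket r q) *\<^sub>C bracket x b) \<otimes>\<^sub>C ?t r q)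
        = bracket x (bracket r q) \<otimes>\<^sub>C ?t r q"
      by (simp add: clinear_sum[OF clinear_pure_tensor(1)])
  qed
  also have "\<dots> = cubic (\<lambda>p q r. killing x (bracket (bracket r q) p))"
    unfolding cubic_def
  proof (intro sum.cong refl)
    fix r q
    have "bracket x (bracket r q)
        = (\<Sum>p\<in>Basis. killing x (bracket (bracket r q) p) *\<^sub>C dual p)"
      by (subst dual_expansion) (simp only: killing_invariant)
    then show "bracket x (bracket r q) \<otimes>\<^sub>C ?t r q
        = (\<Sum>p\<in>Basis. killing x (bracket (bracket r q) p) *\<^sub>C (dual p \<otimes>\<^sub>C ?t r q))"
      by (simp add: clinear_sum[OF clinear_pure_tensor(1)] pure_tensor_simps)
  qed
  finally show ?thesis .
qed

lemma cobracket_jacobi: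
  "tensor_map id cobracket (cobracket x)
    + tensor_cycle (tensor_map id cobracket (cobracket x))
    + tensor_cycle (tensor_cycle (tensor_map id cobracket (cobracket x))) = 0"
proof -
  \<comment> \<open>The three cyclic rotations of the coefficients add up to the Jacobi identity.\<close>
  have "killing x (bracket (bracket r q) p) + killing x (bracket (bracket q p) r)
      + killing x (bracket (bracket p r) q) = 0" for p q r
  proof -
    have rev: "bracket (bracket a b) c = bracket c (bracket b a)" for a b c
      using bracket_antisym[of "bracket a b" c] bracket_antisym[of a b] by (simp add: bracket_minus)
    have "bracket (bracket r q) p + bracket (bracket q p) r + bracket (bracket p r) q = 0"
      using jacobi[of p q r] by (simp only: rev add.assoc add.commute[of "bracket r (bracket p q)"])
    then show ?thesis
      using killing_zero_left[of x] by (simp add: killing_sym[of x 0] flip: killing_add_right)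
  qed
  then show ?thesis
    by (simp add: cobracket_iterated tensor_cycle_cubic cubic_add) (simp add: cubic_def)
qed

text \<open>The composition is the Casimir operator of the adjoint representation. Paired with \<open>y\<close>, it gives
  by invariance \<open>tr (ad y ad x)\<close>, which is again the Killing form of \<open>y\<close> and \<open>x\<close>; so it is the
  identity, without a normalizing factor.\<close>
lemma bracket_cobracket: "tensor_lift bracket (cobracket x) = x"
proof -
  have "killing (tensor_lift bracket (cobracket x) - x) y = 0" for y
  proof -
    have "killing (bracket (bracket x b) c) y = killing (bracket y (bracket x b)) c" for b c
    proof -
      have "killing (bracket (bracket x b) c) y = killing y (bracket (bracket x b) c)"
        by (rule killing_sym)
      then show ?thesis by (simp only: killing_invariant)
    qed
    then have "killing (tensor_lift bracket (cobracket x)) y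
        = (\<Sum>b\<in>Basis. killing (bracket y (bracket x b)) (dual b))"
      by (simp add: cobracket_def clinear_sum[OF clinear_tensor_lift[OF cbilinear_bracket]]
          tensor_lift_pure[OF cbilinear_bracket] killing_sum_left)
    also have "\<dots> = killing y x"
      by (simp only: killing_def[of y x] trace_dual)
    finally show ?thesis by (simp add: killing_diff_left killing_sym[of y x])
  qed
  then show ?thesis
    using killing_nondegenerate by (metis eq_iff_diff_eq_0)
qed

theorem co_split_cobracket: "co_split_lie_algebra bracket cobracket"
  by (intro co_split_lie_algebra.intro lie_algebra_axioms lie_coalgebra.intro
      co_split_lie_algebra_axioms.intro clinear_cobracket cobracket_antisymmetric cobracket_jacobi)
     (simp add: bracket_cobracket fun_eq_iff)

end

theorem theorem6p1:
  fixes bracket :: "'a::complex_vector \<Rightarrow> 'a \<Rightarrow> 'a"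
  assumes "\<exists>B. finite_dimensional_vector_space (scaleC :: complex \<Rightarrow> 'a \<Rightarrow> 'a) B"
    and "simple_lie_algebra bracket"
  shows "\<exists>\<delta> :: 'a \<Rightarrow> ('a, 'a) tensor. co_split_lie_algebra bracket \<delta>"
proof -
  obtain B where B: "finite_dimensional_vector_space (scaleC :: complex \<Rightarrow> 'a \<Rightarrow> 'a) B"
    using assms(1) by blast
  interpret simple_lie_algebra bracket by (rule assms(2))
  interpret finite_dimensional_vector_space "scaleC :: complex \<Rightarrow> 'a \<Rightarrow> 'a" B by (rule B)
  interpret fin_dim_simple_lie_algebra bracket B ..
  show ?thesis using co_split_cobracket by blast
qed

end
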